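(* Let $m,s$ be positive integers such that $s\geq 2$ and $m\geq 6s$. Suppose $\mathcal{X}=\{x_k\}_{k=1}^s\subseteq\mathbb{T}$ consists of separated clumps with parameters $(s,\delta,r,\lambda,\alpha,\beta)$ such that $0<\delta\leq\frac1m$. If $r>1$, also assume that $\beta\geq\frac{3\lambda}{m}$. Set $\tau=\frac12$ if $r=1$, and $\tau=\beta$ otherwise. Then $\mathcal{X}$ satisfies the $(m,\tau)$ density criterion, i.e. $\frac{3\nu(\tau,\mathcal{X})}{\tau}\leq m$. Moreover, defining for each $k=1,\dots,s$ $$\mathcal{G}_k:=\mathcal{G}(x_k,\tau,\mathcal{X}),\quad r_k:=|\mathcal{B}(x_k,\tau,\mathcal{X})|,\quad n_k:=\left\lfloor m-\frac{2\nu(\tau,\mathcal{G}_k)}{\tau}\right\rfloor,\quad \alpha_k:=\frac{r_k}{2m-4\nu(\tau,\mathcal{G}_k)\tau^{-1}},$$ $$\mathcal{I}_k:=\{x\in\mathcal{X}\colon 0<|x-x_k|_{\mathbb{T}}\leq\alpha_k\},\qquad \mathcal{J}_k:=\{x\in\mathcal{X}\colon \alpha_k<|x-x_k|_{\mathbb{T}}\leq\tau\},$$ the following inequalities hold: $$\frac{1}{\sigma_s^2(\Phi(m,\mathcal{X}))}\leq\sum_{k=1}^s 2^{\nu(\tau,\mathcal{G}_k)}\,\frac{2\alpha_k}{1-2\alpha_k}\prod_{x\in\mathcal{J}_k}\phi\left(\frac{1}{2|x-x_k|_{\mathbb{T}}}\right)^2\prod_{x\in\mathcal{I}_k}\frac{\alpha_k^2}{(1-2\alpha_k)^2|x-x_k|_{\mathbb{T}}^2},$$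 $$\sigma_s(\Phi(m,\mathcal{X}))\geq\min_{1\leq k\leq s}\left\{\frac{1}{\sqrt{4s\alpha_k}}\,\frac{1}{\sqrt{2^{\nu(\tau,\mathcal{G}_k)}}}\,\frac{1}{2^{|\mathcal{J}_k|}}\prod_{x\in\mathcal{I}_k}\frac{|x-x_k|_{\mathbb{T}}}{2\alpha_k}\right\},$$ $$\frac{1}{\sigma_s^2(\Phi(m,\mathcal{X}))}\leq\frac{4e^2}{\pi^2}\sum_{k=1}^s 2^{\nu(\tau,\mathcal{G}_k)}\,\frac{\phi(\frac{n_k}{r_k})}{r_kn_k}\left(\frac{2e\,\phi(\frac{n_k}{r_k})}{\sin(\frac{\pi}{2}n_k\delta)}\right)^{2r_k-2},$$ $$\sigma_s(\Phi(m,\mathcal{X}))\geq\frac{\pi}{2e}\sqrt{\frac{m}{6s}}\;\min_{1\leq k\leq s}\left\{\sqrt{\frac{r_k}{2^{\nu(\tau,\mathcal{G}_k)}}}\left(\frac{m\delta}{12e}\right)^{r_k-1}\right\}.$$ In particular, $$\sigma_s(\Phi(m,\mathcal{X}))\geq\frac{\pi}{2e}\sqrt{\frac{m}{12s}}\left(\frac{m\delta}{12\sqrt2\,e}\right)^{\lambda-1}.$$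
   Context: $\mathbb{T}:=\mathbb{R}/\mathbb{Z}$ and $|t|_{\mathbb{T}}:=\min_{n\in\mathbb{Z}}|t-n|$. The minimum separation of $\mathcal{X}=\{x_k\}_{k=1}^s$ is $\Delta(\mathcal{X}):=\min_{j\neq k}|x_j-x_k|_{\mathbb{T}}$. For a set $\mathcal{X}=\{x_k\}_{k=1}^s\subseteq\mathbb{T}$ of cardinality $s$ and an integer $m\geq s$, the Fourier matrix is the $m\times s$ matrix $\Phi(m,\mathcal{X}):=[e^{-2\pi i j x_k}]_{j=0,\dots,m-1,\;k=1,\dots,s}$, and $\sigma_k(\Phi)$ denotes its $k$-th largest singular value, so $\sigma_s$ is the smallest. For $\mathcal{U},\mathcal{V}\subseteq\mathbb{T}$, $\mathrm{diam}(\mathcal{U}):=\sup_{u,u'\in\mathcal{U}}|u-u'|_{\mathbb{T}}$ and $\mathrm{dist}(\mathcal{U},\mathcal{V}):=\inf_{u\in\mathcal{U},v\in\mathcal{V}}|u-v|_{\mathbb{T}}$. A set $\mathcal{X}\subseteq\mathbb{T}$ consists of separated clumps with parameters $(s,\delta,r,\lambda,\alpha,\beta)$ if $|\mathcal{X}|=s$, $\Delta(\mathcal{X})\geq\delta$, and there is a disjoint union $\mathcal{X}=\mathcal{C}_1\cup\cdots\cup\mathcal{C}_r$ into nonempty sets (clumps) such that $\max_{1\leq k\leq r}|\mathcal{C}_k|=\lambda$, $\max_{1\leq k\leq r}\mathrm{diam}(\mathcal{C}_k)\leq\alpha$, and, if $r\geq2$, $\min_{j\neq k}\mathrm{dist}(\mathcal{C}_j,\mathcal{C}_k)>\beta>\alpha$.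 For $\tau\in(0,\frac12]$ and a finite set $\mathcal{U}\subseteq\mathbb{T}$, the $\tau$ local sparsity is $\nu(\tau,\mathcal{U}):=\max_{u\in\mathcal{U}}|\{u'\in\mathcal{U}\colon|u-u'|_{\mathbb{T}}\leq\tau\}|$, with $\nu(\tau,\emptyset):=0$. For $x\in\mathcal{X}$, $\mathcal{B}(x,\tau,\mathcal{X}):=\{x'\in\mathcal{X}\colon|x-x'|_{\mathbb{T}}\leq\tau\}$ and $\mathcal{G}(x,\tau,\mathcal{X}):=\{x'\in\mathcal{X}\colon|x-x'|_{\mathbb{T}}>\tau\}$. The function $\phi\colon[1,\infty)\to[1,\infty)$ is $\phi(t):=t/\lfloor t\rfloor$. A product over an empty set equals $1$. *)

theory Defs
  imports "HOL-Analysis.Analysis" "Jordan_Normal_Form.Schur_Decomposition"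
begin

section \<open>The torus\<close>

quotient_type torus = real / "\<lambda>x y :: real. x - y \<in> \<int>"
proof (rule equivpI)
  show "reflp (\<lambda>x y :: real. x - y \<in> \<int>)"
    by (simp add: reflp_def)
  show "symp (\<lambda>x y :: real. x - y \<in> \<int>)"
  proof (rule sympI)
    fix x y :: real
    assume "x - y \<in> \<int>"
    then have "- (x - y) \<in> \<int>" by (rule Ints_minus)
    then show "y - x \<in> \<int>" by simp
  qed
  show "transp (\<lambda>x y :: real. x - y \<in> \<int>)"
  proof (rule transpI)
    fix x y z :: real
    assume "x - y \<in> \<int>" "y - z \<in> \<int>"
    then have "(x - y) + (y - z) \<in> \<int>" by (rule Ints_add)
    then show "x - z \<in> \<int>" by simp
  qed
qed

instantiation torus :: ab_group_add
begin

lift_definition zero_torus :: torus is "0 :: real" .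

lift_definition plus_torus :: "torus \<Rightarrow> torus \<Rightarrow> torus" is "(+) :: real \<Rightarrow> real \<Rightarrow> real"
proof -
  fix a b c d :: real
  assume "a - b \<in> \<int>" "c - d \<in> \<int>"
  then have "(a - b) + (c - d) \<in> \<int>" by (rule Ints_add)
  then show "(a + c) - (b + d) \<in> \<int>" by (simp add: algebra_simps)
qed

lift_definition minus_torus :: "torus \<Rightarrow> torus \<Rightarrow> torus" is "(-) :: real \<Rightarrow> real \<Rightarrow> real"
proof -
  fix a b c d :: real
  assume "a - b \<in> \<int>" "c - d \<in> \<int>"
  then have "(a - b) - (c - d) \<in> \<int>" by (rule Ints_diff)
  then show "(a - c) - (b - d) \<in> \<int>" by (simp add: algebra_simps)
qed

lift_definition uminus_torus :: "torus \<Rightarrow> torus" is "uminus :: real \<Rightarrow> real"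
proof -
  fix a b :: real
  assume "a - b \<in> \<int>"
  then have "- (a - b) \<in> \<int>" by (rule Ints_minus)
  then show "- a - - b \<in> \<int>" by simp
qed

instance
  by standard (transfer; simp)+

end

lemma INF_abs_diff_int: "(INF n::int. \<bar>t - of_int n\<bar>) = \<bar>t - of_int (round t)\<bar>" for t :: real
  by (rule cInf_eq_minimum) (auto simp: round_diff_minimal)

(* The infimum is a minimum, by the lemma above. *)
lift_definition torus_norm :: "torus \<Rightarrow> real" ("\<bar>_\<bar>\<^sub>T")
  is "\<lambda>t. INF n::int. \<bar>t - of_int n\<bar>"
proof -
  fix t u :: real
  assume "t - u \<in> \<int>"
  then obtain k where k: "t - u = of_int k" by (rule Ints_cases)
  have "range (\<lambda>n::int. \<bar>t - of_int n\<bar>) = range (\<lambda>n::int. \<bar>u - of_int n\<bar>)"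
  proof (intro subset_antisym image_subsetI)
    fix n :: int
    have "\<bar>t - of_int n\<bar> = \<bar>u - of_int (n - k)\<bar>" using k by (simp add: algebra_simps)
    then show "\<bar>t - of_int n\<bar> \<in> range (\<lambda>n::int. \<bar>u - of_int n\<bar>)" by (rule range_eqI)
  next
    fix n :: int
    have "\<bar>u - of_int n\<bar> = \<bar>t - of_int (n + k)\<bar>" using k by (simp add: algebra_simps)
    then show "\<bar>u - of_int n\<bar> \<in> range (\<lambda>n::int. \<bar>t - of_int n\<bar>)" by (rule range_eqI)
  qed
  then show "(INF n::int. \<bar>t - of_int n\<bar>) = (INF n::int. \<bar>u - of_int n\<bar>)" by simp
qed

lift_definition torus_char :: "nat \<Rightarrow> torus \<Rightarrow> complex"
  is "\<lambda>j x. exp (- 2 * of_real pi * \<i> * of_nat j * of_real x)"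
proof -
  fix j :: nat and x y :: real
  assume "x - y \<in> \<int>"
  then obtain k where "x - y = of_int k" by (rule Ints_cases)
  then have k: "x = y + of_int k" by simp
  have "exp (- 2 * of_real pi * \<i> * of_nat j * of_real x)
      = exp (- 2 * of_real pi * \<i> * of_nat j * of_real y + of_int (2 * (- (int j * k))) * (of_real pi * \<i>))"
    unfolding k by (simp add: algebra_simps)
  also have "\<dots> = exp (- 2 * of_real pi * \<i> * of_nat j * of_real y)"
    by (subst exp_eq) (rule exI[of _ "- (int j * k)"], simp)
  finally show "exp (- 2 * of_real pi * \<i> * of_nat j * of_real x)
      = exp (- 2 * of_real pi * \<i> * of_nat j * of_real y)" .
qed


section \<open>Singular values and Fourier matrices\<close>

(* Square roots of the eigenvalues of A\<^sup>* A, listed in decreasing order with algebraic multiplicity;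
   there are as many of them as A has columns. The eigenvalues are real and nonnegative, so Re
   loses nothing. *)
definition singular_values :: "complex mat \<Rightarrow> real list" where
  "singular_values A = rev (sorted_list_of_multiset
     (image_mset (\<lambda>z. sqrt (Re z)) (proots (char_poly (mat_adjoint A * A)))))"

(* The k-th largest singular value, with k counted from 1. *)
definition singular_value :: "nat \<Rightarrow> complex mat \<Rightarrow> real" where
  "singular_value k A = singular_values A ! (k - 1)"

(* The nodes x 1, ..., x s are counted from 1, whereas matrix indices start at 0. *)
definition fourier_matrix :: "nat \<Rightarrow> nat \<Rightarrow> (nat \<Rightarrow> torus) \<Rightarrow> complex mat" where
  "fourier_matrix m s x = mat m s (\<lambda>(j, k). torus_char j (x (k + 1)))"


section \<open>Geometry of finite subsets of the torus\<close>

(* Only meaningful for finite sets with at least two elements. *)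
definition min_sep :: "torus set \<Rightarrow> real" where
  "min_sep X = Min {\<bar>x - y\<bar>\<^sub>T |x y. x \<in> X \<and> y \<in> X \<and> x \<noteq> y}"

definition torus_diam :: "torus set \<Rightarrow> real" where
  "torus_diam U = (SUP (u, u') \<in> U \<times> U. \<bar>u - u'\<bar>\<^sub>T)"

definition torus_setdist :: "torus set \<Rightarrow> torus set \<Rightarrow> real" where
  "torus_setdist U V = (INF (u, v) \<in> U \<times> V. \<bar>u - v\<bar>\<^sub>T)"

definition separated_clumps ::
  "torus set \<Rightarrow> nat \<Rightarrow> real \<Rightarrow> nat \<Rightarrow> nat \<Rightarrow> real \<Rightarrow> real \<Rightarrow> bool" where
  "separated_clumps X s \<delta> r lam \<alpha> \<beta> \<longleftrightarrow>
     finite X \<and> card X = s \<and> min_sep X \<ge> \<delta> \<and> r \<ge> 1 \<and>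
     (\<exists>C :: nat \<Rightarrow> torus set.
        X = (\<Union>k\<in>{1..r}. C k) \<and>
        disjoint_family_on C {1..r} \<and>
        (\<forall>k\<in>{1..r}. C k \<noteq> {}) \<and>
        (MAX k\<in>{1..r}. card (C k)) = lam \<and>
        (MAX k\<in>{1..r}. torus_diam (C k)) \<le> \<alpha> \<and>
        (r \<ge> 2 \<longrightarrow>
           Min {torus_setdist (C j) (C k) |j k. j \<in> {1..r} \<and> k \<in> {1..r} \<and> j \<noteq> k} > \<beta> \<and>
           \<beta> > \<alpha>))"

definition local_sparsity :: "real \<Rightarrow> torus set \<Rightarrow> nat" where
  "local_sparsity \<tau> U =
     (if U = {} then 0 else MAX u\<in>U. card {u'\<in>U. \<bar>u - u'\<bar>\<^sub>T \<le> \<tau>})"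

definition density_criterion :: "nat \<Rightarrow> real \<Rightarrow> torus set \<Rightarrow> bool" where
  "density_criterion m \<tau> X \<longleftrightarrow> 3 * local_sparsity \<tau> X / \<tau> \<le> m"

definition near_set :: "torus \<Rightarrow> real \<Rightarrow> torus set \<Rightarrow> torus set" where
  "near_set x \<tau> X = {x'\<in>X. \<bar>x - x'\<bar>\<^sub>T \<le> \<tau>}"

definition far_set :: "torus \<Rightarrow> real \<Rightarrow> torus set \<Rightarrow> torus set" where
  "far_set x \<tau> X = {x'\<in>X. \<bar>x - x'\<bar>\<^sub>T > \<tau>}"

(* Only used for t \<ge> 1. *)
definition phi :: "real \<Rightarrow> real" where
  "phi t = t / \<lfloor>t\<rfloor>"

end

theory Submission
  imports Defs
begin

text \<open>
Write \<open>z\<^sub>k\<close> for the value of the basic character at \<open>x\<^sub>k\<close>. If polynomials \<open>p\<^sub>k\<close> of degree less than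
\<open>m\<close> satisfy \<open>p\<^sub>k(z\<^sub>l) = 1\<close> for \<open>l = k\<close> and \<open>0\<close> otherwise, then pairing their coefficients with
\<open>\<Phi> v\<close> recovers the entries of \<open>v\<close>, so \<open>1 / \<sigma>\<^sup>2\<close> is at most the sum of the squared coefficient norms
of the \<open>p\<^sub>k\<close>. Each \<open>p\<^sub>k\<close> is a product of three factors.

The far nodes are coloured greedily with \<open>\<nu>\<close> colours such that each colour class, together with \<open>x\<^sub>k\<close>,
is \<open>\<tau>\<close>-separated. For such a class the Gram matrix of the exponentials with sine weights
\<open>sin (\<pi> j / M)\<close>, where \<open>M = \<lfloor>2 / \<tau>\<rfloor> + 2\<close>, is diagonally dominant: its entries are bounded by differences
of cotangents, which telescope. Inverting it yields an interpolant of degree at most \<open>2 / \<tau>\<close> bounded by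
\<open>\<surd>2\<close> on the unit circle; this is the source of the factor \<open>2 ^ \<nu>\<close>.

A near node \<open>y\<close> is removed by the factor \<open>z ^ q - z\<^sub>y ^ q\<close>, normalised at \<open>z\<^sub>k\<close>, with
\<open>q = min \<lfloor>t\<rfloor> \<lfloor>1 / (2 d)\<rfloor>\<close>, where \<open>d\<close> is the distance to \<open>x\<^sub>k\<close> and \<open>t = (m - 2 \<nu> / \<tau>) / r\<^sub>k\<close>; it is bounded by
\<open>1 / sin (\<pi> q d)\<close>. The last factor is the normalised geometric sum of length \<open>\<lfloor>t\<rfloor>\<close>, which is small in the
quadratic norm. All stated bounds come from estimating the resulting product of sines, the third one by
ordering the near nodes by distance and a Stirling-type bound for \<open>\<Prod>j<n. (j div 2 + 1)\<close>.
\<close>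

section \<open>The torus and its basic character\<close>

lemma torus_norm_abs_torus_le: "\<bar>abs_torus t\<bar>\<^sub>T \<le> \<bar>t - of_int k\<bar>"
proof -
  have "\<bar>abs_torus t\<bar>\<^sub>T = \<bar>t - of_int (round t)\<bar>"
    by (simp add: torus_norm.abs_eq INF_abs_diff_int)
  then show ?thesis
    using round_diff_minimal[of t k] by simp
qed

text \<open>Rounding selects a representative in [-1/2, 1/2], where the torus norm is the ordinary
  absolute value.\<close>

lemma torus_rep:
  obtains t where "u = abs_torus t" "\<bar>u\<bar>\<^sub>T = \<bar>t\<bar>" "\<bar>t\<bar> \<le> 1 / 2"
proof -
  obtain t0 where u: "u = abs_torus t0" by (metis Quotient_torus Quotient_abs_rep)
  define t where "t = t0 - of_int (round t0)"
  have "u = abs_torus t"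
    unfolding u t_def by (simp add: torus.abs_eq_iff)
  moreover have "\<bar>u\<bar>\<^sub>T = \<bar>t\<bar>"
    unfolding u t_def by (simp add: torus_norm.abs_eq INF_abs_diff_int)
  moreover have "\<bar>t\<bar> \<le> 1 / 2"
    unfolding t_def using of_int_round_abs_le[of t0] by (simp add: abs_minus_commute)
  ultimately show ?thesis using that by blast
qed

lemma torus_norm_le_half: "\<bar>u\<bar>\<^sub>T \<le> 1 / 2"
  by (rule torus_rep[of u]) simp

lemma torus_norm_nonneg [simp]: "\<bar>u\<bar>\<^sub>T \<ge> 0"
  by (rule torus_rep[of u]) simp

lemma torus_norm_zero [simp]: "\<bar>0\<bar>\<^sub>T = 0"
  using torus_norm_abs_torus_le[of 0 0] torus_norm_nonneg[of 0] unfolding zero_torus_def by simp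

lemma torus_norm_eq_0_iff [simp]: "\<bar>u\<bar>\<^sub>T = 0 \<longleftrightarrow> u = 0"
proof
  assume "\<bar>u\<bar>\<^sub>T = 0"
  then show "u = 0"
    by (metis torus_rep abs_eq_0 zero_torus_def)
qed simp

lemma torus_norm_minus_commute: "\<bar>u - v\<bar>\<^sub>T = \<bar>v - u\<bar>\<^sub>T"
proof -
  have le: "\<bar>- w\<bar>\<^sub>T \<le> \<bar>w\<bar>\<^sub>T" for w
  proof (rule torus_rep[of w])
    fix t assume t: "w = abs_torus t" "\<bar>w\<bar>\<^sub>T = \<bar>t\<bar>"
    have "- w = abs_torus (- t)" unfolding t(1) by (simp add: uminus_torus.abs_eq)
    then show "\<bar>- w\<bar>\<^sub>T \<le> \<bar>w\<bar>\<^sub>T" using torus_norm_abs_torus_le[of "- t" 0] t by simp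
  qed
  show ?thesis using le[of "u - v"] le[of "v - u"] by simp
qed

text \<open>The basic character exp (-2 pi i u), which places the nodes on the unit circle. The
  Fourier matrix is the Vandermonde matrix of these points, so a row of coefficients times the
  matrix lists the values of a polynomial at the nodes.\<close>

definition zeta :: "torus \<Rightarrow> complex" where
  "zeta u = torus_char 1 u"

lemma zeta_abs_torus: "zeta (abs_torus t) = cis (- (2 * pi * t))"
  by (simp add: zeta_def torus_char.abs_eq cis_conv_exp algebra_simps)

lemma torus_char_power: "torus_char j u = zeta u ^ j"
  by (rule torus_rep[of u]) (simp add: zeta_def torus_char.abs_eq exp_of_nat_mult [symmetric] algebra_simps)

lemma norm_zeta [simp]: "norm (zeta u) = 1"
  by (rule torus_rep[of u]) (simp add: zeta_abs_torus)

lemma zeta_nonzero [simp]: "zeta u \<noteq> 0"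
  using norm_zeta[of u] by (metis norm_zero zero_neq_one)

lemma zeta_diff: "zeta (u - v) = zeta u * cnj (zeta v)"
proof -
  obtain s t where "u = abs_torus s" "v = abs_torus t" by (metis torus_rep)
  then show ?thesis
    by (simp only: minus_torus.abs_eq zeta_abs_torus cis_cnj cis_mult) (simp add: algebra_simps)
qed

text \<open>Half-angle argument: up to a unimodular factor the difference is w^2 - 1 = w (w - cnj
  w), and w - cnj w is purely imaginary. Only the modulus of the sine enters, so the sign of
  \<open>t\<close> is left open.\<close>

lemma norm_zeta_power_diff:
  assumes "\<bar>t\<bar> = \<bar>u - v\<bar>\<^sub>T"
  shows "norm (zeta u ^ q - zeta v ^ q) = 2 * \<bar>sin (pi * q * t)\<bar>"
proof -
  obtain t' where t': "u - v = abs_torus t'" "\<bar>u - v\<bar>\<^sub>T = \<bar>t'\<bar>" by (metis torus_rep)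
  have tt: "t = t' \<or> t = - t'" using assms t' by linarith
  define w where "w = cis (- (pi * q * t'))"
  have "zeta u ^ q - zeta v ^ q = zeta v ^ q * (zeta (u - v) ^ q - 1)"
  proof -
    have "zeta v * cnj (zeta v) = 1"
      using complex_norm_square[of "zeta v"] by (metis norm_zeta of_real_1 power_one)
    then have "(zeta v ^ q) * (cnj (zeta v) ^ q) = 1" by (metis power_mult_distrib power_one)
    then show ?thesis by (simp add: zeta_diff algebra_simps)
  qed
  moreover have "zeta (u - v) ^ q = w * w"
    unfolding t'(1) zeta_abs_torus w_def cis_mult Complex.DeMoivre
    by (rule arg_cong[of _ _ cis]) (simp add: algebra_simps)
  moreover have "w * w - 1 = w * (w - cnj w)"
    using complex_norm_square[of w] by (simp add: algebra_simps w_def)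
  moreover have "w - cnj w = - 2 * \<i> * sin (pi * q * t')"
    unfolding w_def by (simp add: complex_eq_iff)
  ultimately have "norm (zeta u ^ q - zeta v ^ q) = 2 * \<bar>sin (pi * q * t')\<bar>"
    by (simp add: norm_mult norm_power w_def)
  then show ?thesis using tt by auto
qed


section \<open>The sine kernel\<close>

text \<open>The sequence sin (j theta) satisfies a linear recurrence whose characteristic polynomial
  is the quadratic factor; multiplying by that factor leaves boundary terms only.\<close>

lemma sin_sum_generating:
  fixes w :: complex
  shows "(1 - 2 * of_real (cos \<theta>) * w + w\<^sup>2) * (\<Sum>j\<le>M. of_real (sin (j * \<theta>)) * w ^ j)
    = of_real (sin \<theta>) * w - of_real (sin ((M + 1) * \<theta>)) * w ^ (M + 1) + of_real (sin (M * \<theta>)) * w ^ (M + 2)"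
proof (induction M)
  case 0
  show ?case by simp
next
  case (Suc M)
  have "sin ((real M + 2) * \<theta>) = 2 * cos \<theta> * sin ((real M + 1) * \<theta>) - sin (real M * \<theta>)"
    using sin_add[of "(real M + 1) * \<theta>" \<theta>] sin_diff[of "(real M + 1) * \<theta>" \<theta>]
    by (simp add: algebra_simps)
  then have *: "complex_of_real (sin ((real M + 2) * \<theta>))
      = 2 * of_real (cos \<theta>) * of_real (sin ((real M + 1) * \<theta>)) - of_real (sin (real M * \<theta>))"
    by simp
  have "(1 - 2 * of_real (cos \<theta>) * w + w\<^sup>2) * (\<Sum>j\<le>Suc M. of_real (sin (j * \<theta>)) * w ^ j)
    = (1 - 2 * of_real (cos \<theta>) * w + w\<^sup>2) * (\<Sum>j\<le>M. of_real (sin (j * \<theta>)) * w ^ j)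
      + (1 - 2 * of_real (cos \<theta>) * w + w\<^sup>2) * (of_real (sin ((real M + 1) * \<theta>)) * w ^ (M + 1))"
    by (simp add: algebra_simps)
  also have "\<dots> = of_real (sin \<theta>) * w - (2 * of_real (cos \<theta>) * of_real (sin ((real M + 1) * \<theta>)) - of_real (sin (real M * \<theta>))) * w ^ (M + 2)
      + of_real (sin ((real M + 1) * \<theta>)) * w ^ (M + 3)"
    unfolding Suc.IH by (simp add: algebra_simps power_add eval_nat_numeral)
  also have "\<dots> = of_real (sin \<theta>) * w - of_real (sin ((real M + 2) * \<theta>)) * w ^ (M + 2)
      + of_real (sin ((real M + 1) * \<theta>)) * w ^ (M + 3)"
    unfolding * ..
  finally show ?case by (simp add: eval_nat_numeral algebra_simps)
qed

text \<open>The weights are nonnegative and vanish at both ends \<open>j = 0\<close> and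
  \<open>j = M\<close>, which later saves two degrees.\<close>

definition sine_kernel :: "nat \<Rightarrow> complex \<Rightarrow> complex" where
  "sine_kernel M w = (\<Sum>j\<le>M. of_real (sin (j * (pi / M))) * w ^ j)"

lemma sine_kernel_closed_form:
  assumes "M > 0"
  shows "(1 - 2 * of_real (cos (pi / M)) * w + w\<^sup>2) * sine_kernel M w
    = of_real (sin (pi / M)) * (w + w ^ (M + 1))"
proof -
  have "(real M + 1) * (pi / M) = pi + pi / M"
    using assms by (simp add: distrib_right add_divide_distrib)
  then have "sin ((real M + 1) * (pi / M)) = - sin (pi / M)"
    by simp
  then show ?thesis
    using assms sin_sum_generating[of "pi / M" w M]
    by (simp add: sine_kernel_def distrib_left)
qed

text \<open>At w = 1 the closed form reads 4 sin^2 h on one side and 4 sin h cos h on the other,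
  with h = pi / (2 M). This value is the common diagonal entry of the Gram matrix below.\<close>

lemma sine_kernel_one:
  assumes "M \<ge> 2"
  shows "sine_kernel M 1 = of_real (cot (pi / (2 * real M)))"
proof -
  define h where "h = pi / (2 * real M)"
  have th: "pi / M = 2 * h" by (simp add: h_def)
  have h: "0 < h" "h < pi"
    using assms pi_gt_zero by (auto simp: h_def field_simps)
  then have sh: "sin h > 0" by (simp add: sin_gt_zero)
  have "of_real (2 - 2 * cos (2 * h)) * sine_kernel M 1 = of_real (2 * sin (2 * h))"
    using sine_kernel_closed_form[of M 1] assms by (simp add: th algebra_simps)
  moreover have "2 - 2 * cos (2 * h) = 4 * (sin h)\<^sup>2"
    by (simp add: cos_double_sin)
  moreover have "2 * sin (2 * h) = 4 * (sin h)\<^sup>2 * cot h"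
    using sh by (simp add: sin_double cot_def power2_eq_square)
  ultimately have "of_real (4 * (sin h)\<^sup>2) * sine_kernel M 1 = of_real (4 * (sin h)\<^sup>2) * of_real (cot h)"
    by (metis of_real_mult)
  then show ?thesis using sh unfolding h_def by auto
qed

lemma cot_diff:
  assumes "sin (a::real) \<noteq> 0" "sin b \<noteq> 0"
  shows "cot a - cot b = sin (b - a) / (sin a * sin b)"
  unfolding cot_def sin_diff using diff_frac_eq[OF assms, of "cos a" "cos b"]
  by (metis mult.commute)

lemma cot_antimono:
  assumes "0 < a" "a \<le> b" "b < (pi::real)"
  shows "cot b \<le> cot a"
proof -
  have "sin a > 0" "sin b > 0" "sin (b - a) \<ge> 0"
    using assms by (auto intro: sin_gt_zero sin_ge_zero)
  then have "cot a - cot b \<ge> 0" by (simp add: cot_diff)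
  then show ?thesis by simp
qed

text \<open>With h = pi / (2 M), the quadratic factor has modulus 4 sin (pi t - h) sin (pi t + h)
  and the numerator is at most 2 sin (2 h). The quotient is written as a difference of cotangents so
  that sums over separated points telescope.\<close>

lemma norm_sine_kernel_le:
  assumes M: "M \<ge> 2" and t: "pi / (2 * real M) < pi * t" "pi * t < pi - pi / (2 * real M)"
  shows "norm (sine_kernel M (cis (2 * pi * t)))
    \<le> (cot (pi * t - pi / (2 * real M)) - cot (pi * t + pi / (2 * real M))) / 2"
proof -
  define h where "h = pi / (2 * real M)"
  define w where "w = cis (2 * pi * t)"
  define d where "d = sin (pi * t - h) * sin (pi * t + h)"
  have th: "pi / M = 2 * h" by (simp add: h_def)
  have h: "0 < h" "h \<le> pi / 4"
    using M by (auto simp: h_def field_simps)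
  have s: "sin (pi * t - h) > 0" "sin (pi * t + h) > 0"
    using t[folded h_def] h by (auto intro!: sin_gt_zero)
  have "1 - 2 * of_real (cos (2 * h)) * w + w\<^sup>2 = w * (cnj w + w - 2 * of_real (cos (2 * h)))"
    using complex_norm_square[of w] by (simp add: w_def algebra_simps power2_eq_square)
  also have "cnj w + w - 2 * of_real (cos (2 * h)) = of_real (2 * cos (2 * (pi * t)) - 2 * cos (2 * h))"
    by (simp add: w_def complex_eq_iff mult.assoc)
  also have "2 * cos (2 * (pi * t)) - 2 * cos (2 * h) = - 4 * d"
    unfolding d_def sin_times_sin by (simp add: algebra_simps)
  finally have "norm (1 - 2 * of_real (cos (2 * h)) * w + w\<^sup>2) = 4 * d"
    using s by (simp add: norm_mult w_def d_def)
  moreover have "norm (of_real (sin (2 * h)) * (w + w ^ (M + 1))) \<le> sin (2 * h) * 2"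
  proof -
    have "norm (w + w ^ (M + 1)) \<le> 2"
      using norm_triangle_ineq[of w "w ^ (M + 1)"] by (simp add: w_def norm_power norm_mult)
    moreover have "sin (2 * h) \<ge> 0" using h by (intro sin_ge_zero) auto
    ultimately show ?thesis by (simp add: norm_mult mult_left_mono)
  qed
  ultimately have "4 * d * norm (sine_kernel M w) \<le> sin (2 * h) * 2"
    using sine_kernel_closed_form[of M w] M unfolding th
    by (metis norm_mult gr0I not_numeral_le_zero)
  moreover have "d > 0" using s by (simp add: d_def)
  moreover have "cot (pi * t - h) - cot (pi * t + h) = sin (2 * h) / d"
    using s cot_diff[of "pi * t - h" "pi * t + h"] by (simp add: d_def)
  ultimately have "d * (2 * norm (sine_kernel M w)) \<le> d * (cot (pi * t - h) - cot (pi * t + h))"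
    by simp
  then have "2 * norm (sine_kernel M w) \<le> cot (pi * t - h) - cot (pi * t + h)"
    using \<open>d > 0\<close> mult_le_cancel_left_pos by blast
  then show ?thesis
    unfolding h_def w_def by simp
qed

text \<open>The intervals of radius \<open>e\<close> around the points do not overlap, so the drops
  of \<open>H\<close> over them add up to at most its total drop. The induction removes the largest
  point and lowers \<open>hi\<close> to the left end of its interval.\<close>

lemma telescoping_antimono_bound:
  fixes H :: "real \<Rightarrow> real"
  assumes "finite S" and "lo \<le> hi"
    and anti: "\<And>x y. \<lbrakk>lo \<le> x; x \<le> y; y \<le> hi\<rbrakk> \<Longrightarrow> H y \<le> H x"
    and "\<And>x. x \<in> S \<Longrightarrow> lo \<le> x - e \<and> x + e \<le> hi"
    and "e \<ge> 0"
    and "\<And>x y. \<lbrakk>x \<in> S; y \<in> S; x \<noteq> y\<rbrakk> \<Longrightarrow> 2 * e \<le> \<bar>x - y\<bar>"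
  shows "(\<Sum>x\<in>S. H (x - e) - H (x + e)) \<le> H lo - H hi"
  using assms(1,2,3,4,6)
proof (induction S arbitrary: hi rule: finite_linorder_max_induct)
  case empty
  then show ?case using empty by simp
next
  case (insert b A)
  have b: "lo \<le> b - e" "b + e \<le> hi" using insert.prems(3) by auto
  have "(\<Sum>x\<in>A. H (x - e) - H (x + e)) \<le> H lo - H (b - e)"
  proof (rule insert.IH)
    fix x assume x: "x \<in> A"
    have "x < b" using insert.hyps x by auto
    then have "2 * e \<le> b - x"
      using insert.prems(4)[of x b] x by auto
    then show "lo \<le> x - e \<and> x + e \<le> b - e"
      using insert.prems(3)[of x] x by auto
  next
    fix x y assume "lo \<le> x" "x \<le> y" "y \<le> b - e"
    then show "H y \<le> H x" using insert.prems(2) b \<open>e \<ge> 0\<close> by auto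
  qed (use b insert.prems in auto)
  moreover have "b \<notin> A" using insert.hyps by auto
  moreover have "H hi \<le> H (b + e)" using insert.prems(2) b \<open>e \<ge> 0\<close> by auto
  ultimately show ?case using insert.hyps by simp
qed

text \<open>Row-sum bound for the Gram matrix: the off-diagonal moduli amount to at most half of the
  diagonal value in \<open>sine_kernel_one\<close>.\<close>

lemma sum_sine_kernel_le:
  assumes M: "2 / \<tau> + 1 \<le> M" and \<tau>: "0 < \<tau>" "\<tau> \<le> 1 / 2"
    and "finite S"
    and range: "\<And>t. t \<in> S \<Longrightarrow> \<tau> \<le> t \<and> t \<le> 1 - \<tau>"
    and sep: "\<And>t u. \<lbrakk>t \<in> S; u \<in> S; t \<noteq> u\<rbrakk> \<Longrightarrow> \<tau> \<le> \<bar>t - u\<bar>"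
  shows "(\<Sum>t\<in>S. norm (sine_kernel M (cis (2 * pi * t)))) \<le> cot (pi / (2 * real M)) / 2"
proof -
  define e where "e = 1 / (2 * real M)"
  have M4: "real M \<ge> 5" 
  proof -
    have "4 \<le> 2 / \<tau>" using \<tau> by (simp add: field_simps)
    then show ?thesis using M by linarith
  qed
  then have e0: "e > 0" by (simp add: e_def)
  \<comment> \<open>The size of \<open>M\<close> forces \<open>e\<close> below a quarter of
    \<open>\<tau>\<close>: the intervals of radius \<open>e\<close> are disjoint, and 2 e stays
    below \<open>\<tau> - e\<close>.\<close>
  have "2 < real M * \<tau>" using M \<tau> by (simp add: field_simps)
  then have e\<tau>: "4 * e < \<tau>" using M4 by (simp add: e_def field_simps)
  have pe: "pi / (2 * real M) = pi * e" by (simp add: e_def)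
  define H where "H = (\<lambda>t. cot (pi * t))"
  have "(\<Sum>t\<in>S. norm (sine_kernel M (cis (2 * pi * t)))) \<le> (\<Sum>t\<in>S. (H (t - e) - H (t + e)) / 2)"
  proof (rule sum_mono)
    fix t assume "t \<in> S"
    then have "e < t" "t < 1 - e" using range[of t] e\<tau> e0 by auto
    then have "pi * e < pi * t" "pi * t < pi * (1 - e)" using pi_gt_zero by auto
    then show "norm (sine_kernel M (cis (2 * pi * t))) \<le> (H (t - e) - H (t + e)) / 2"
      using norm_sine_kernel_le[of M t] M4 unfolding pe H_def by (simp add: algebra_simps)
  qed
  also have "\<dots> = (\<Sum>t\<in>S. H (t - e) - H (t + e)) / 2"
    by (simp add: sum_divide_distrib)
  also have "\<dots> \<le> (H (\<tau> - e) - H (1 - (\<tau> - e))) / 2"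
  proof (rule divide_right_mono, rule telescoping_antimono_bound)
    fix x y assume "\<tau> - e \<le> x" "x \<le> y" "y \<le> 1 - (\<tau> - e)"
    then have "0 < x" "x \<le> y" "y < 1" using e\<tau> e0 by auto
    then show "H y \<le> H x" unfolding H_def using pi_gt_zero by (intro cot_antimono) auto
  next
    fix t assume "t \<in> S"
    then show "\<tau> - e \<le> t - e \<and> t + e \<le> 1 - (\<tau> - e)" using range[of t] by simp
  next
    fix t u assume "t \<in> S" "u \<in> S" "t \<noteq> u"
    then show "2 * e \<le> \<bar>t - u\<bar>" using sep[of t u] e0 e\<tau> by linarith
  qed (use \<open>finite S\<close> e0 e\<tau> \<tau> in auto)
  \<comment> \<open>The cotangent is odd about pi / 2, so both ends of the telescoped sum contribute
    equally.\<close>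
  also have "H (1 - (\<tau> - e)) = - H (\<tau> - e)"
    unfolding H_def cot_def by (simp add: right_diff_distrib)
  also have "(H (\<tau> - e) - - H (\<tau> - e)) / 2 = cot (pi * (\<tau> - e))"
    by (simp add: H_def)
  also have "\<dots> \<le> cot (2 * (pi * e))"
  proof (rule cot_antimono)
    show "2 * (pi * e) \<le> pi * (\<tau> - e)"
      using mult_left_mono[of "2 * e" "\<tau> - e" pi] e\<tau> e0 by simp
    show "pi * (\<tau> - e) < pi"
      using e0 \<tau> by simp
  qed (use e0 in simp)
  \<comment> \<open>Double-angle formula cot (2 y) = (cot y - tan y) / 2 with a positive
    tangent.\<close>
  also have "\<dots> \<le> cot (pi * e) / 2"
  proof -
    define y where "y = pi * e"
    have "0 < y" "y < pi / 2" using e0 e\<tau> \<tau> by (auto simp: y_def)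
    then have y: "sin y > 0" "cos y > 0" by (auto intro: sin_gt_zero cos_gt_zero)
    have "cot (2 * y) = (cos y * cos y - sin y * sin y) / (2 * (sin y * cos y))"
      by (simp add: cot_def sin_double cos_double power2_eq_square)
    also have "\<dots> = cot y / 2 - sin y / (2 * cos y)"
      using y by (simp add: cot_def diff_divide_distrib)
    finally show ?thesis using y unfolding y_def by simp
  qed
  finally show ?thesis unfolding pe .
qed


section \<open>Bounded interpolation from a diagonally dominant Gram matrix\<close>

text \<open>Injectivity becomes solvability through the determinant. Index functions in place of
  matrices keep the later arguments at the level of finite sums.\<close>

lemma matrix_solve:
  fixes K :: "nat \<Rightarrow> nat \<Rightarrow> complex"
  assumes inj: "\<And>v. \<lbrakk>\<And>k. k < n \<Longrightarrow> (\<Sum>l<n. K k l * v l) = 0\<rbrakk> \<Longrightarrow> (\<And>l. l < n \<Longrightarrow> v l = 0)"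
  obtains c where "\<And>k. k < n \<Longrightarrow> (\<Sum>l<n. K k l * c l) = b k"
proof -
  define A where "A = mat n n (\<lambda>(k, l). K k l)"
  have A: "A \<in> carrier_mat n n" by (simp add: A_def)
  have mult: "(A *\<^sub>v v) $ k = (\<Sum>l<n. K k l * v $ l)" if "v \<in> carrier_vec n" "k < n" for v k
    using that by (simp add: A_def scalar_prod_def atLeast0LessThan)
  have "det A \<noteq> 0"
  proof
    assume "det A = 0"
    then obtain v where v: "v \<in> carrier_vec n" "v \<noteq> 0\<^sub>v n" "A *\<^sub>v v = 0\<^sub>v n"
      unfolding det_0_iff_vec_prod_zero[OF A] by blast
    have "v $ l = 0" if "l < n" for l
    proof (rule inj[OF _ that])
      fix k assume "k < n"
      then show "(\<Sum>l<n. K k l * v $ l) = 0" using mult[OF v(1)] v(3) by simp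
    qed
    then show False using v(1,2) by (metis eq_vecI carrier_vecD index_zero_vec)
  qed
  then have "A \<in> Units (ring_mat TYPE(complex) n ())"
    by (rule det_non_zero_imp_unit[OF A])
  then obtain B where B: "B \<in> carrier_mat n n" "A * B = 1\<^sub>m n"
    unfolding Units_def ring_mat_def by auto
  define c where "c = B *\<^sub>v vec n b"
  have c: "c \<in> carrier_vec n" using B by (simp add: c_def)
  have "A *\<^sub>v c = (A * B) *\<^sub>v vec n b"
    unfolding c_def by (rule assoc_mult_mat_vec[symmetric, OF A B(1)]) simp
  also have "\<dots> = vec n b" using B by simp
  finally have "A *\<^sub>v c = vec n b" .
  then have "(\<Sum>l<n. K k l * c $ l) = b k" if "k < n" for k
    using mult[OF c that] that by simp
  then show ?thesis by (rule that)
qed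

text \<open>Gershgorin-type estimate: the mixed terms are split by 2 a b <= a^2 + b^2, and the
  symmetry of the moduli makes both halves equal to the same weighted row sum
  \<open>O1\<close>.\<close>

lemma diagonally_dominant_form:
  fixes K :: "'a \<Rightarrow> 'a \<Rightarrow> complex"
  assumes "finite A"
    and diag: "\<And>k. k \<in> A \<Longrightarrow> K k k = of_real d"
    and sym: "\<And>k l. \<lbrakk>k \<in> A; l \<in> A\<rbrakk> \<Longrightarrow> norm (K k l) = norm (K l k)"
    and off: "\<And>k. k \<in> A \<Longrightarrow> (\<Sum>l\<in>A - {k}. norm (K k l)) \<le> e"
  shows "(d - e) * (\<Sum>k\<in>A. (norm (v k))\<^sup>2) \<le> Re (\<Sum>k\<in>A. \<Sum>l\<in>A. cnj (v k) * v l * K k l)"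
proof -
  define O1 where "O1 = (\<Sum>k\<in>A. \<Sum>l\<in>A - {k}. (norm (v k))\<^sup>2 * norm (K k l))"
  have O1: "O1 \<le> e * (\<Sum>k\<in>A. (norm (v k))\<^sup>2)"
    unfolding O1_def sum_distrib_left
  proof (rule sum_mono)
    fix k assume "k \<in> A"
    then have "(norm (v k))\<^sup>2 * (\<Sum>l\<in>A - {k}. norm (K k l)) \<le> (norm (v k))\<^sup>2 * e"
      using off by (intro mult_left_mono) auto
    then show "(\<Sum>l\<in>A - {k}. (norm (v k))\<^sup>2 * norm (K k l)) \<le> e * (norm (v k))\<^sup>2"
      by (simp add: sum_distrib_left mult.commute)
  qed
  have swap: "(\<Sum>k\<in>A. \<Sum>l\<in>A - {k}. (norm (v l))\<^sup>2 * norm (K k l)) = O1"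
  proof -
    have "(\<Sum>k\<in>A. \<Sum>l\<in>A - {k}. (norm (v l))\<^sup>2 * norm (K k l))
        = (\<Sum>k\<in>A. \<Sum>l\<in>A. if l = k then 0 else (norm (v l))\<^sup>2 * norm (K k l))"
      using \<open>finite A\<close> by (intro sum.cong sum.mono_neutral_cong_left) auto
    also have "\<dots> = (\<Sum>l\<in>A. \<Sum>k\<in>A. if l = k then 0 else (norm (v l))\<^sup>2 * norm (K k l))"
      by (rule sum.swap)
    also have "\<dots> = O1"
      unfolding O1_def using \<open>finite A\<close> sym
      by (intro sum.cong refl sum.mono_neutral_cong_right) auto
    finally show ?thesis .
  qed
  have "Re (\<Sum>k\<in>A. \<Sum>l\<in>A. cnj (v k) * v l * K k l)
      = (\<Sum>k\<in>A. d * (norm (v k))\<^sup>2 + (\<Sum>l\<in>A - {k}. Re (cnj (v k) * v l * K k l)))"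
    unfolding Re_sum
  proof (rule sum.cong[OF refl])
    fix k assume k: "k \<in> A"
    have "Re (cnj (v k) * v k * K k k) = d * (norm (v k))\<^sup>2"
      using diag[OF k] by (simp add: cmod_power2) (simp add: power2_eq_square algebra_simps)
    then show "(\<Sum>l\<in>A. Re (cnj (v k) * v l * K k l))
        = d * (norm (v k))\<^sup>2 + (\<Sum>l\<in>A - {k}. Re (cnj (v k) * v l * K k l))"
      using k \<open>finite A\<close> by (simp add: sum.remove)
  qed
  also have "\<dots> \<ge> (\<Sum>k\<in>A. d * (norm (v k))\<^sup>2 - (\<Sum>l\<in>A - {k}. ((norm (v k))\<^sup>2 + (norm (v l))\<^sup>2) / 2 * norm (K k l)))"
  proof -
    have "- (((norm (v k))\<^sup>2 + (norm (v l))\<^sup>2) / 2 * norm (K k l)) \<le> Re (cnj (v k) * v l * K k l)" for k l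
    proof -
      have "- Re (cnj (v k) * v l * K k l) \<le> norm (v k) * norm (v l) * norm (K k l)"
        using abs_Re_le_cmod[of "cnj (v k) * v l * K k l"] by (simp add: norm_mult)
      also have "\<dots> \<le> ((norm (v k))\<^sup>2 + (norm (v l))\<^sup>2) / 2 * norm (K k l)"
        using sum_squares_bound[of "norm (v k)" "norm (v l)"] by (intro mult_right_mono) auto
      finally show ?thesis by simp
    qed
    then show ?thesis
      by (intro sum_mono) (simp add: sum_negf[symmetric] sum_mono)
  qed
  moreover have "(\<Sum>k\<in>A. \<Sum>l\<in>A - {k}. ((norm (v k))\<^sup>2 + (norm (v l))\<^sup>2) / 2 * norm (K k l)) = (O1 + O1) / 2"
  proof -
    have eq: "((norm (v k))\<^sup>2 + (norm (v l))\<^sup>2) / 2 * norm (K k l)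
        = (norm (v k))\<^sup>2 * norm (K k l) / 2 + (norm (v l))\<^sup>2 * norm (K k l) / 2" for k l
      by (simp add: field_simps)
    show ?thesis
      unfolding eq by (simp only: sum.distrib sum_divide_distrib[symmetric] swap O1_def[symmetric] add_divide_distrib)
  qed
  ultimately show ?thesis using O1 by (simp add: left_diff_distrib sum_subtractf sum_distrib_left[symmetric])
qed

text \<open>The interpolant is sought in the span of the weighted kernels at the nodes, with Gram
  matrix \<open>K\<close>. Coercivity of \<open>K\<close> with constant d / 2 controls the energy of
  the solution, and Cauchy-Schwarz turns the energy into a bound on the whole unit circle.\<close>

lemma bounded_interpolation:
  fixes z :: "nat \<Rightarrow> complex" and W :: "nat \<Rightarrow> real"
  assumes n: "k0 < n" and "finite J"
    and unit: "\<And>i. i < n \<Longrightarrow> norm (z i) = 1"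
    and W: "\<And>j. j \<in> J \<Longrightarrow> W j \<ge> 0" and d: "d = (\<Sum>j\<in>J. W j)" "d > 0"
    and off: "\<And>k. k < n \<Longrightarrow>
       (\<Sum>l\<in>{..<n} - {k}. norm (\<Sum>j\<in>J. of_real (W j) * (z k * cnj (z l)) ^ j)) \<le> d / 2"
  obtains S :: "nat \<Rightarrow> complex"
    where "(\<Sum>j\<in>J. of_real (W j) * S j * z k0 ^ j) = 1"
      and "\<And>k. \<lbrakk>k \<noteq> k0; k < n\<rbrakk> \<Longrightarrow> (\<Sum>j\<in>J. of_real (W j) * S j * z k ^ j) = 0"
      and "\<And>w. norm w = 1 \<Longrightarrow> (norm (\<Sum>j\<in>J. of_real (W j) * S j * w ^ j))\<^sup>2 \<le> 2"
proof -
  define K where "K = (\<lambda>k l. \<Sum>j\<in>J. of_real (W j) * (z k * cnj (z l)) ^ j)"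
  have form: "d / 2 * (\<Sum>k<n. (norm (v k))\<^sup>2) \<le> Re (\<Sum>k<n. \<Sum>l<n. cnj (v k) * v l * K k l)" for v
  proof -
    have "(d - d / 2) * (\<Sum>k<n. (norm (v k))\<^sup>2) \<le> Re (\<Sum>k<n. \<Sum>l<n. cnj (v k) * v l * K k l)"
    proof (rule diagonally_dominant_form)
      fix k assume "k \<in> {..<n}"
      then have "z k * cnj (z k) = 1"
        using unit[of k] complex_norm_square[of "z k"] by simp
      then show "K k k = of_real d" by (simp add: K_def d)
    next
      fix k l
      have "K l k = cnj (K k l)" unfolding K_def by (simp add: mult.commute)
      then show "norm (K k l) = norm (K l k)" by simp
    qed (use off in \<open>auto simp: K_def\<close>)
    then show ?thesis by simp
  qed
  obtain c where c: "\<And>k. k < n \<Longrightarrow> (\<Sum>l<n. K k l * c l) = (if k = k0 then 1 else 0)"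
  proof (rule matrix_solve[of n K "\<lambda>k. if k = k0 then 1 else 0"])
    fix v :: "nat \<Rightarrow> complex" and l
    assume v: "\<And>k. k < n \<Longrightarrow> (\<Sum>l<n. K k l * v l) = 0" and l: "l < n"
    have "(\<Sum>k<n. \<Sum>l<n. cnj (v k) * v l * K k l) = (\<Sum>k<n. cnj (v k) * (\<Sum>l<n. K k l * v l))"
      by (simp add: sum_distrib_left algebra_simps)
    also have "\<dots> = 0" using v by simp
    finally have "d / 2 * (\<Sum>k<n. (norm (v k))\<^sup>2) \<le> 0" using form[of v] by simp
    then have "(\<Sum>k<n. (norm (v k))\<^sup>2) \<le> 0" using d(2) by (simp add: mult_le_0_iff)
    moreover have "(norm (v l))\<^sup>2 \<le> (\<Sum>k<n. (norm (v k))\<^sup>2)"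
      using l by (intro member_le_sum) auto
    ultimately show "v l = 0"
      by (metis le_less_trans not_less zero_less_norm_iff zero_less_power order_trans)
  qed blast
  define S where "S = (\<lambda>j. \<Sum>l<n. c l * cnj (z l) ^ j)"
  have val: "(\<Sum>j\<in>J. of_real (W j) * S j * z k ^ j) = (if k = k0 then 1 else 0)" if "k < n" for k
  proof -
    have "(\<Sum>j\<in>J. of_real (W j) * S j * z k ^ j)
        = (\<Sum>j\<in>J. \<Sum>l<n. of_real (W j) * (z k * cnj (z l)) ^ j * c l)"
      unfolding S_def by (simp add: sum_distrib_left sum_distrib_right power_mult_distrib mult_ac)
    also have "\<dots> = (\<Sum>l<n. K k l * c l)"
      unfolding K_def sum_distrib_right by (rule sum.swap)
    finally show ?thesis using c that by simp
  qed
  define E where "E = (\<Sum>j\<in>J. W j * (norm (S j))\<^sup>2)"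
  have quad: "(\<Sum>k<n. \<Sum>l<n. cnj (c k) * c l * K k l) = cnj (c k0)"
  proof -
    have "(\<Sum>k<n. \<Sum>l<n. cnj (c k) * c l * K k l) = (\<Sum>k<n. cnj (c k) * (\<Sum>l<n. K k l * c l))"
      by (simp add: sum_distrib_left algebra_simps)
    also have "\<dots> = (\<Sum>k<n. if k = k0 then cnj (c k) else 0)"
      using c by (intro sum.cong) auto
    also have "\<dots> = cnj (c k0)" using n by simp
    finally show ?thesis .
  qed
  \<comment> \<open>The energy is the quadratic form of \<open>K\<close> at \<open>c\<close>, which
    the linear system reduces to one entry; that entry is therefore real and nonnegative.\<close>
  have E: "of_real E = cnj (c k0)"
  proof -
    have "of_real E = (\<Sum>j\<in>J. of_real (W j) * (S j * cnj (S j)))"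
      unfolding E_def by (simp only: of_real_sum of_real_mult complex_norm_square)
    also have "\<dots> = (\<Sum>j\<in>J. \<Sum>k<n. cnj (c k) * (of_real (W j) * S j * z k ^ j))"
      unfolding S_def by (simp add: sum_distrib_left mult_ac)
    also have "\<dots> = (\<Sum>k<n. cnj (c k) * (\<Sum>j\<in>J. of_real (W j) * S j * z k ^ j))"
      unfolding sum_distrib_left by (rule sum.swap)
    also have "\<dots> = (\<Sum>k<n. if k = k0 then cnj (c k) else 0)"
      using val by (intro sum.cong) auto
    also have "\<dots> = cnj (c k0)" using n by simp
    finally show ?thesis .
  qed
  have E0: "E \<ge> 0" unfolding E_def using W by (intro sum_nonneg) auto
  have nc: "norm (c k0) = E" using E E0 by (metis complex_mod_cnj norm_of_real abs_of_nonneg)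
  \<comment> \<open>Since \<open>E\<close> is the modulus of \<open>c k0\<close>, coercivity says d
    / 2 times E^2 is at most E, whence d E <= 2.\<close>
  have "d / 2 * (norm (c k0))\<^sup>2 \<le> d / 2 * (\<Sum>k<n. (norm (c k))\<^sup>2)"
    using n d by (intro mult_left_mono member_le_sum) auto
  also have "\<dots> \<le> E" using form[of c] unfolding quad E[symmetric] by simp
  finally have "E * (d * E) \<le> E * 2" unfolding nc by (simp add: power2_eq_square mult_ac)
  then have dE: "d * E \<le> 2" using E0 by (cases "E = 0") auto
  show ?thesis
  proof (rule that)
    fix w :: complex assume w: "norm w = 1"
    have "norm (\<Sum>j\<in>J. of_real (W j) * S j * w ^ j) \<le> (\<Sum>j\<in>J. norm (of_real (W j) * S j * w ^ j))"
      by (rule norm_sum)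
    also have "\<dots> = (\<Sum>j\<in>J. sqrt (W j) * (sqrt (W j) * norm (S j)))"
      using W w by (intro sum.cong) (auto simp: norm_mult norm_power)
    finally have "(norm (\<Sum>j\<in>J. of_real (W j) * S j * w ^ j))\<^sup>2 \<le> (\<Sum>j\<in>J. sqrt (W j) * (sqrt (W j) * norm (S j)))\<^sup>2"
      by (intro power_mono) auto
    also have "\<dots> \<le> (\<Sum>j\<in>J. (sqrt (W j))\<^sup>2) * (\<Sum>j\<in>J. (sqrt (W j) * norm (S j))\<^sup>2)"
      by (rule Cauchy_Schwarz_ineq_sum)
    also have "\<dots> = d * E"
      unfolding d E_def using W by (simp add: power_mult_distrib)
    finally show "(norm (\<Sum>j\<in>J. of_real (W j) * S j * w ^ j))\<^sup>2 \<le> 2" using dE by simp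
  qed (use val n in auto)
qed


section \<open>Interpolation at the far nodes\<close>

text \<open>Lifts are chosen for all points at once, in [0, 1) and with reversed sign, so that
  \<open>zeta\<close> is \<open>cis\<close> of a nonnegative angle and differences of lifts dominate
  torus distances.\<close>

lemma torus_frac_rep:
  obtains L :: "torus \<Rightarrow> real" where "\<And>u. zeta u = cis (2 * pi * L u)" "\<And>u. \<bar>u\<bar>\<^sub>T \<le> L u" "\<And>u. \<bar>u\<bar>\<^sub>T \<le> 1 - L u"
    "\<And>u v. \<bar>u - v\<bar>\<^sub>T \<le> \<bar>L u - L v\<bar>"
proof -
  have "\<exists>t. u = abs_torus (- t) \<and> 0 \<le> t \<and> t < 1" for u
  proof -
    obtain s where s: "u = abs_torus s" by (metis torus_rep)
    have "s - - frac (- s) = of_int (- \<lfloor>- s\<rfloor>)" by (simp add: frac_def)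
    then have "s - - frac (- s) \<in> \<int>" by (metis Ints_of_int)
    then have "u = abs_torus (- frac (- s))" unfolding s by (simp only: torus.abs_eq_iff)
    then show ?thesis using frac_ge_0[of "- s"] frac_lt_1[of "- s"] by blast
  qed
  then obtain L where L: "\<And>u. u = abs_torus (- L u)" "\<And>u. 0 \<le> L u" "\<And>u. L u < 1" by metis
  show ?thesis
  proof
    fix u v
    show "zeta u = cis (2 * pi * L u)" by (subst L(1)) (simp add: zeta_abs_torus)
    show "\<bar>u\<bar>\<^sub>T \<le> L u"
      using torus_norm_abs_torus_le[of "- L u" 0] L[of u] by simp
    show "\<bar>u\<bar>\<^sub>T \<le> 1 - L u"
      using torus_norm_abs_torus_le[of "- L u" "-1"] L[of u] by simp
    have "u - v = abs_torus (- L u - - L v)"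
      by (metis L(1) minus_torus.abs_eq)
    then show "\<bar>u - v\<bar>\<^sub>T \<le> \<bar>L u - L v\<bar>"
      using torus_norm_abs_torus_le[of "- L u - - L v" 0] by simp
  qed
qed

text \<open>For each fixed node, the lifts of the differences to the other nodes are
  \<open>\<tau>\<close>-separated and stay \<open>\<tau>\<close> away from 0 and 1. The kernel
  estimate thus makes the Gram matrix diagonally dominant.\<close>

lemma separated_interpolant:
  assumes "finite U" "u0 \<in> U" and \<tau>: "0 < \<tau>" "\<tau> \<le> 1 / 2"
    and sep: "\<And>u v. \<lbrakk>u \<in> U; v \<in> U; u \<noteq> v\<rbrakk> \<Longrightarrow> \<tau> \<le> \<bar>u - v\<bar>\<^sub>T"
  obtains g :: "complex poly" where "degree g \<le> nat \<lfloor>2 / \<tau>\<rfloor>" "poly g (zeta u0) = 1"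
    "\<And>u. \<lbrakk>u \<in> U; u \<noteq> u0\<rbrakk> \<Longrightarrow> poly g (zeta u) = 0"
    "\<And>w. norm w = 1 \<Longrightarrow> (norm (poly g w))\<^sup>2 \<le> 2"
proof -
  obtain L where L: "\<And>u. zeta u = cis (2 * pi * L u)" "\<And>u. \<bar>u\<bar>\<^sub>T \<le> L u" "\<And>u. \<bar>u\<bar>\<^sub>T \<le> 1 - L u"
    "\<And>u v. \<bar>u - v\<bar>\<^sub>T \<le> \<bar>L u - L v\<bar>"
    using torus_frac_rep by blast
  obtain e where e: "bij_betw e {..<card U} U"
    using ex_bij_betw_nat_finite[OF \<open>finite U\<close>] by (auto simp: atLeast0LessThan)
  define n where "n = card U"
  have inj: "inj_on e {..<n}" and im: "e ` {..<n} = U"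
    using e by (auto simp: bij_betw_def n_def)
  obtain k0 where k0: "k0 < n" "e k0 = u0" using im \<open>u0 \<in> U\<close> by blast
  define M where "M = nat \<lfloor>2 / \<tau>\<rfloor> + 2"
  define W where "W = (\<lambda>j::nat. sin (j * (pi / M)))"
  have M: "M \<ge> 2" "2 / \<tau> + 1 \<le> M"
    using \<tau> by (auto simp: M_def) linarith
  have W0: "W 0 = 0" "W M = 0" using M by (auto simp: W_def)
  have Wpos: "W j \<ge> 0" if "j \<in> {..M}" for j
    unfolding W_def
  proof (rule sin_ge_zero)
    show "real j * (pi / real M) \<le> pi"
      using that M by (simp add: field_simps)
  qed simp
  define d where "d = (\<Sum>j\<le>M. W j)"
  have "of_real d = sine_kernel M 1"
    by (simp add: d_def W_def sine_kernel_def)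
  then have d: "d = cot (pi / (2 * real M))"
    using sine_kernel_one[OF M(1)] by (metis of_real_eq_iff)
  have "pi / (2 * real M) < pi / 2"
    using M(1) by (simp add: field_simps)
  then have dpos: "d > 0"
    unfolding d cot_def using M(1) by (intro divide_pos_pos cos_gt_zero sin_gt_zero2) auto
  have off: "(\<Sum>l\<in>{..<n} - {k}. norm (\<Sum>j\<le>M. of_real (W j) * (zeta (e k) * cnj (zeta (e l))) ^ j)) \<le> d / 2"
    if k: "k < n" for k
  proof -
    define T where "T = (\<lambda>l. L (e k - e l))"
    have Tsep: "\<tau> \<le> \<bar>T l - T l'\<bar>" if "l < n" "l' < n" "l \<noteq> l'" for l l'
    proof -
      have "e l' \<noteq> e l" using inj that by (auto dest: inj_onD)
      then have "\<tau> \<le> \<bar>e l' - e l\<bar>\<^sub>T" using sep im that by blast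
      also have "\<dots> \<le> \<bar>T l - T l'\<bar>"
        unfolding T_def using L(4)[of "e k - e l" "e k - e l'"] by simp
      finally show ?thesis .
    qed
    have Tinj: "inj_on T ({..<n} - {k})"
    proof (rule inj_onI)
      fix l l' assume "l \<in> {..<n} - {k}" "l' \<in> {..<n} - {k}" "T l = T l'"
      then show "l = l'" using Tsep[of l l'] \<tau> by auto
    qed
    have zT: "zeta (e k) * cnj (zeta (e l)) = cis (2 * pi * T l)" for l
      by (metis T_def L(1) zeta_diff)
    have "(\<Sum>l\<in>{..<n} - {k}. norm (\<Sum>j\<le>M. of_real (W j) * (zeta (e k) * cnj (zeta (e l))) ^ j))
        = (\<Sum>t\<in>T ` ({..<n} - {k}). norm (sine_kernel M (cis (2 * pi * t))))"
      unfolding sum.reindex[OF Tinj] zT by (simp add: sine_kernel_def W_def)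
    also have "\<dots> \<le> cot (pi / (2 * real M)) / 2"
    proof (rule sum_sine_kernel_le[OF M(2) \<tau>])
      fix t assume "t \<in> T ` ({..<n} - {k})"
      then obtain l where l: "l < n" "l \<noteq> k" "t = T l" by auto
      then have "e k \<noteq> e l" using inj k by (auto dest: inj_onD)
      then have "\<tau> \<le> \<bar>e k - e l\<bar>\<^sub>T" using sep im k l by blast
      then show "\<tau> \<le> t \<and> t \<le> 1 - \<tau>"
        using L(2,3)[of "e k - e l"] unfolding l T_def by linarith
    qed (use Tsep in auto)
    finally show ?thesis unfolding d .
  qed
  obtain S where S: "(\<Sum>j\<le>M. of_real (W j) * S j * zeta (e k0) ^ j) = 1"
      "\<And>k. \<lbrakk>k \<noteq> k0; k < n\<rbrakk> \<Longrightarrow> (\<Sum>j\<le>M. of_real (W j) * S j * zeta (e k) ^ j) = 0"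
      "\<And>w. norm w = 1 \<Longrightarrow> (norm (\<Sum>j\<le>M. of_real (W j) * S j * w ^ j))\<^sup>2 \<le> 2"
  proof (rule bounded_interpolation[OF k0(1) finite_atMost[of M], of "\<lambda>i. zeta (e i)" W d])
    show "norm (zeta (e i)) = 1" for i by simp
  qed (use Wpos d_def dpos off in blast)+
  \<comment> \<open>As the weights vanish at 0 and \<open>M\<close>, the interpolant is w times a
    polynomial of degree at most M - 2. Dividing by w and multiplying by \<open>zeta u0\<close>
    preserves the value 1 at \<open>zeta u0\<close>, the zeros and the bound on the circle.\<close>
  define g where "g = (\<Sum>j\<in>{1..<M}. monom (zeta u0 * of_real (W j) * S j) (j - 1))"
  have g: "w * poly g w = zeta u0 * (\<Sum>j\<le>M. of_real (W j) * S j * w ^ j)" for w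
  proof -
    have "w * poly g w = (\<Sum>j\<in>{1..<M}. zeta u0 * (of_real (W j) * S j * w ^ j))"
      unfolding g_def poly_sum poly_monom sum_distrib_left
    proof (rule sum.cong[OF refl])
      fix j assume "j \<in> {1..<M}"
      then have "w ^ j = w * w ^ (j - 1)" by (cases j) auto
      then show "w * (zeta u0 * of_real (W j) * S j * w ^ (j - 1)) = zeta u0 * (of_real (W j) * S j * w ^ j)"
        by simp
    qed
    also have "\<dots> = (\<Sum>j\<le>M. zeta u0 * (of_real (W j) * S j * w ^ j))"
    proof (rule sum.mono_neutral_left)
      show "\<forall>j\<in>{..M} - {1..<M}. zeta u0 * (of_real (W j) * S j * w ^ j) = 0"
      proof
        fix j assume "j \<in> {..M} - {1..<M}"
        then have "j = 0 \<or> j = M" by auto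
        then show "zeta u0 * (of_real (W j) * S j * w ^ j) = 0" using W0 by auto
      qed
    qed auto
    finally show ?thesis by (simp add: sum_distrib_left)
  qed
  show ?thesis
  proof
    show "degree g \<le> nat \<lfloor>2 / \<tau>\<rfloor>"
      unfolding g_def
    proof (rule degree_sum_le)
      fix j assume "j \<in> {1..<M}"
      then show "degree (monom (zeta u0 * of_real (W j) * S j) (j - 1)) \<le> nat \<lfloor>2 / \<tau>\<rfloor>"
        using degree_monom_le[of "zeta u0 * of_real (W j) * S j" "j - 1"] by (auto simp: M_def)
    qed simp
    show "poly g (zeta u0) = 1"
      using g[of "zeta u0"] S(1) k0(2) by simp
    show "poly g (zeta u) = 0" if u: "u \<in> U" "u \<noteq> u0" for u
    proof -
      obtain k where "k < n" "e k = u" using im u by blast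
      moreover have "k \<noteq> k0" using \<open>e k = u\<close> u k0 by auto
      ultimately show ?thesis using S(2)[of k] g[of "zeta u"] by simp
    qed
    show "(norm (poly g w))\<^sup>2 \<le> 2" if w: "norm w = 1" for w
    proof -
      have "norm (poly g w) = norm (w * poly g w)" using w by (simp add: norm_mult)
      also have "\<dots> = norm (\<Sum>j\<le>M. of_real (W j) * S j * w ^ j)"
        unfolding g by (simp add: norm_mult)
      finally show ?thesis using S(3)[OF w] by simp
    qed
  qed
qed

text \<open>The bound counts closed neighbourhoods, so each vertex has fewer than
  \<open>\<nu>\<close> other neighbours and a colour is always free for the vertex inserted
  last.\<close>

lemma greedy_colouring:
  assumes "finite G" and sym: "\<And>u v. R u v \<longleftrightarrow> R v u"
    and "\<And>u. u \<in> G \<Longrightarrow> card {v \<in> G. v = u \<or> R u v} \<le> \<nu>"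
  obtains c :: "'a \<Rightarrow> nat" where "\<And>u. u \<in> G \<Longrightarrow> c u < \<nu>"
    "\<And>u v. \<lbrakk>u \<in> G; v \<in> G; u \<noteq> v; R u v\<rbrakk> \<Longrightarrow> c u \<noteq> c v"
proof -
  have "\<exists>c :: 'a \<Rightarrow> nat. (\<forall>u\<in>G. c u < \<nu>) \<and> (\<forall>u\<in>G. \<forall>v\<in>G. u \<noteq> v \<longrightarrow> R u v \<longrightarrow> c u \<noteq> c v)"
    using assms(1,3)
  proof (induction G)
    case empty
    then show ?case by simp
  next
    case (insert a G)
    have "\<exists>c :: 'a \<Rightarrow> nat. (\<forall>u\<in>G. c u < \<nu>) \<and> (\<forall>u\<in>G. \<forall>v\<in>G. u \<noteq> v \<longrightarrow> R u v \<longrightarrow> c u \<noteq> c v)"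
    proof (rule insert.IH)
      fix u assume u: "u \<in> G"
      have "card {v \<in> G. v = u \<or> R u v} \<le> card {v \<in> insert a G. v = u \<or> R u v}"
        using insert.hyps by (intro card_mono) auto
      then show "card {v \<in> G. v = u \<or> R u v} \<le> \<nu>" using insert.prems[of u] u by simp
    qed
    then obtain c :: "'a \<Rightarrow> nat" where "(\<forall>u\<in>G. c u < \<nu>) \<and>
      (\<forall>u\<in>G. \<forall>v\<in>G. u \<noteq> v \<longrightarrow> R u v \<longrightarrow> c u \<noteq> c v)" ..
    then have c: "\<forall>u\<in>G. c u < \<nu>" "\<forall>u\<in>G. \<forall>v\<in>G. u \<noteq> v \<longrightarrow> R u v \<longrightarrow> c u \<noteq> c v"
      by simp_all
    define N where "N = {v \<in> G. R a v}"
    have N: "finite N" "a \<notin> N" unfolding N_def using insert.hyps by auto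
    have eq: "{v \<in> insert a G. v = a \<or> R a v} = insert a N" unfolding N_def by blast
    have "card {v \<in> insert a G. v = a \<or> R a v} \<le> \<nu>"
      by (rule insert.prems) simp
    then have "card (insert a N) \<le> \<nu>"
      unfolding eq .
    moreover have "card (c ` N) \<le> card N"
      using N by (intro card_image_le)
    ultimately have "card (c ` N) < card {..<\<nu>}" using N by simp
    moreover have "finite (c ` N)" using N by simp
    ultimately have "\<not> {..<\<nu>} \<subseteq> c ` N" using card_mono leD by blast
    then obtain b where b: "b < \<nu>" "b \<notin> c ` N" by auto
    have "(c(a := b)) u \<noteq> (c(a := b)) v" if "u \<in> insert a G" "v \<in> insert a G" "u \<noteq> v" "R u v" for u v
    proof -
      consider "u = a" | "u \<noteq> a" "v = a" | "u \<noteq> a" "v \<noteq> a" by blast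
      then show ?thesis
      proof cases
        case 1
        then have "v \<in> N" using that unfolding N_def by simp
        then have "c v \<in> c ` N" by (rule imageI)
        then show ?thesis using b(2) 1 that(3) by auto
      next
        case 2
        then have "R a u" using that(4) sym[of u a] by blast
        then have "u \<in> N" using that(1) 2 unfolding N_def by simp
        then have "c u \<in> c ` N" by (rule imageI)
        then show ?thesis using b(2) 2 by auto
      next
        case 3
        then show ?thesis using c(2) that by simp
      qed
    qed
    then show ?case using c(1) b(1) insert.hyps by (intro exI[of _ "c(a := b)"]) auto
  qed
  then obtain c :: "'a \<Rightarrow> nat" where c: "(\<forall>u\<in>G. c u < \<nu>) \<and>
    (\<forall>u\<in>G. \<forall>v\<in>G. u \<noteq> v \<longrightarrow> R u v \<longrightarrow> c u \<noteq> c v)" ..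
  show ?thesis by (rule that[of c]) (use c in simp_all)
qed

text \<open>Far nodes within \<open>\<tau>\<close> of each other get different colours, so each
  colour class together with \<open>u0\<close> is separated. The product over the colours pays a
  factor 2 per colour in the squared norm.\<close>

lemma far_interpolant:
  assumes "finite G" and \<tau>: "0 < \<tau>" "\<tau> \<le> 1 / 2"
    and far: "\<And>u. u \<in> G \<Longrightarrow> \<tau> < \<bar>u - u0\<bar>\<^sub>T"
  obtains g :: "complex poly" where "degree g \<le> local_sparsity \<tau> G * nat \<lfloor>2 / \<tau>\<rfloor>" "poly g (zeta u0) = 1"
    "\<And>u. u \<in> G \<Longrightarrow> poly g (zeta u) = 0"
    "\<And>w. norm w = 1 \<Longrightarrow> (norm (poly g w))\<^sup>2 \<le> 2 ^ local_sparsity \<tau> G"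
proof -
  define \<nu> where "\<nu> = local_sparsity \<tau> G"
  have \<nu>: "card {v \<in> G. v = u \<or> \<bar>u - v\<bar>\<^sub>T \<le> \<tau>} \<le> \<nu>" if u: "u \<in> G" for u
  proof -
    have "{v \<in> G. v = u \<or> \<bar>u - v\<bar>\<^sub>T \<le> \<tau>} = {v \<in> G. \<bar>u - v\<bar>\<^sub>T \<le> \<tau>}" using \<tau> by auto
    then show ?thesis
      unfolding \<nu>_def local_sparsity_def using u \<open>finite G\<close> by (auto intro!: Max_ge)
  qed
  obtain c :: "torus \<Rightarrow> nat" where c: "\<And>u. u \<in> G \<Longrightarrow> c u < \<nu>"
    "\<And>u v. \<lbrakk>u \<in> G; v \<in> G; u \<noteq> v; \<bar>u - v\<bar>\<^sub>T \<le> \<tau>\<rbrakk> \<Longrightarrow> c u \<noteq> c v"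
    using greedy_colouring[OF \<open>finite G\<close>, of "\<lambda>u v. \<bar>u - v\<bar>\<^sub>T \<le> \<tau>" \<nu>, OF _ \<nu>]
    by (metis torus_norm_minus_commute)
  define P where "P = (\<lambda>i g. degree g \<le> nat \<lfloor>2 / \<tau>\<rfloor> \<and> poly g (zeta u0) = 1 \<and>
    (\<forall>u\<in>G. c u = i \<longrightarrow> poly g (zeta u) = 0) \<and> (\<forall>w. norm w = 1 \<longrightarrow> (norm (poly g w))\<^sup>2 \<le> 2))"
  have "\<exists>g. P i g" for i
  proof -
    \<comment> \<open>An empty colour class is harmless: \<open>U\<close> is then the singleton of
      \<open>u0\<close>.\<close>
    define U where "U = insert u0 {u \<in> G. c u = i}"
    obtain g :: "complex poly" where "degree g \<le> nat \<lfloor>2 / \<tau>\<rfloor>" "poly g (zeta u0) = 1"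
      "\<And>u. \<lbrakk>u \<in> U; u \<noteq> u0\<rbrakk> \<Longrightarrow> poly g (zeta u) = 0"
      "\<And>w. norm w = 1 \<Longrightarrow> (norm (poly g w))\<^sup>2 \<le> 2"
    proof (rule separated_interpolant[of U u0 \<tau>])
      fix u v assume uv: "u \<in> U" "v \<in> U" "u \<noteq> v"
      show "\<tau> \<le> \<bar>u - v\<bar>\<^sub>T"
        using uv far[of u] far[of v] c(2)[of u v] torus_norm_minus_commute[of u v]
        unfolding U_def by fastforce
    qed (use assms in \<open>auto simp: U_def\<close>)
    moreover have "u \<noteq> u0" if "u \<in> G" for u using far[OF that] \<tau> by auto
    ultimately have "P i g" unfolding P_def U_def by auto
    then show ?thesis ..
  qed
  then obtain g where g: "\<And>i. P i (g i)" by metis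
  define h where "h = (\<Prod>i<\<nu>. g i)"
  show ?thesis
  proof (rule that[of h], unfold \<nu>_def[symmetric])
    have "degree h \<le> (\<Sum>i<\<nu>. degree (g i))" unfolding h_def using degree_prod_sum_le[of "{..<\<nu>}" g] by simp
    also have "\<dots> \<le> (\<Sum>i<\<nu>. nat \<lfloor>2 / \<tau>\<rfloor>)" using g unfolding P_def by (intro sum_mono) auto
    finally show "degree h \<le> \<nu> * nat \<lfloor>2 / \<tau>\<rfloor>" by simp
    show "poly h (zeta u0) = 1" using g unfolding h_def poly_prod P_def by simp
    show "poly h (zeta u) = 0" if "u \<in> G" for u
      unfolding h_def poly_prod using g[of "c u"] c(1)[OF that] that
      by (intro prod_zero) (auto simp: P_def)
    show "(norm (poly h w))\<^sup>2 \<le> 2 ^ \<nu>" if "norm w = 1" for w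
    proof -
      have "(norm (poly h w))\<^sup>2 = (\<Prod>i<\<nu>. (norm (poly (g i) w))\<^sup>2)"
        unfolding h_def poly_prod prod_norm[symmetric] prod_power_distrib ..
      also have "\<dots> \<le> (\<Prod>i<\<nu>. 2)"
        using g that by (intro prod_mono) (auto simp: P_def)
      finally show ?thesis by simp
    qed
  qed
qed


section \<open>Interpolants for a single node\<close>

text \<open>Orthogonality of characters: a geometric sum whose ratio is an \<open>N\<close>-th root
  of unity, different from 1 for distinct exponents because these differ by less than
  \<open>N\<close>.\<close>

lemma sum_cis_multiples:
  assumes "i < N" "l < N"
  shows "(\<Sum>t<N. cis (2 * pi * real t / N) ^ i * cnj (cis (2 * pi * real t / N)) ^ l) = (if i = l then of_nat N else 0)"
proof -
  define w where "w = cis (2 * pi * (real i - real l) / N)"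
  have "cis (2 * pi * real t / N) ^ i * cnj (cis (2 * pi * real t / N)) ^ l = w ^ t" for t :: nat
  proof -
    have "real i * (2 * pi * real t / N) + real l * - (2 * pi * real t / N) = real t * (2 * pi * (real i - real l) / N)"
      by (simp add: algebra_simps diff_divide_distrib)
    then show ?thesis
      unfolding w_def cis_cnj Complex.DeMoivre cis_mult by simp
  qed
  then have sum: "(\<Sum>t<N. cis (2 * pi * real t / N) ^ i * cnj (cis (2 * pi * real t / N)) ^ l) = (\<Sum>t<N. w ^ t)"
    by simp
  show ?thesis
  proof (cases "i = l")
    case True
    then show ?thesis unfolding sum by (simp add: w_def)
  next
    case False
    have N: "N > 0" using assms by simp
    have "real N * (2 * pi * (real i - real l) / N) = 2 * pi * of_int (int i - int l)"
      using N by simp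
    then have "w ^ N = 1"
      unfolding w_def Complex.DeMoivre by (metis cis_multiple_2pi Ints_of_int)
    moreover have "w \<noteq> 1"
    proof
      assume "w = 1"
      then have "exp (\<i> * of_real (2 * pi * (real i - real l) / N)) = 1"
        by (simp add: w_def cis_conv_exp)
      then obtain n :: int where n: "2 * pi * (real i - real l) / N = of_int (2 * n) * pi"
        unfolding exp_eq_1 by auto
      then have "2 * pi * (real i - real l) = 2 * pi * (of_int n * N)" using N by (simp add: field_simps)
      then have "real i - real l = of_int n * real N" by simp
      then have "real_of_int (int i - int l) = real_of_int (n * int N)" by simp
      then have eq: "int i - int l = n * int N" by (simp only: of_int_eq_iff)
      then have "n \<noteq> 0" using False by auto
      then have "1 \<le> \<bar>n\<bar>" by linarith
      then have "int N \<le> \<bar>n * int N\<bar>" by (simp add: abs_mult mult_le_cancel_right1)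
      then show False using eq assms by linarith
    qed
    ultimately show ?thesis unfolding sum using False by (simp add: geometric_sum)
  qed
qed

lemma poly_eq_sum_lessThan:
  fixes p :: "'a :: comm_ring_1 poly"
  assumes "degree p < N"
  shows "poly p w = (\<Sum>i<N. coeff p i * w ^ i)"
  unfolding poly_altdef
  by (rule sum.mono_neutral_left) (use assms in \<open>auto simp: coeff_eq_0\<close>)

text \<open>Parseval at the \<open>N\<close>-th roots of unity, exact for degree below
  \<open>N\<close>; a finite sum takes the place of an integral over the circle.\<close>

lemma discrete_parseval:
  fixes p :: "complex poly"
  assumes "degree p < N"
  shows "(\<Sum>t<N. (norm (poly p (cis (2 * pi * real t / N))))\<^sup>2) = N * (\<Sum>i<N. (norm (coeff p i))\<^sup>2)"
proof -
  let ?w = "\<lambda>t::nat. cis (2 * pi * real t / N)"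
  have "complex_of_real (\<Sum>t<N. (norm (poly p (?w t)))\<^sup>2)
      = (\<Sum>t<N. (\<Sum>i<N. coeff p i * ?w t ^ i) * (\<Sum>l<N. cnj (coeff p l) * cnj (?w t) ^ l))"
    unfolding of_real_sum complex_norm_square poly_eq_sum_lessThan[OF assms]
    by (simp only: cnj_sum complex_cnj_mult complex_cnj_power)
  also have "\<dots> = (\<Sum>t<N. \<Sum>i<N. \<Sum>l<N. coeff p i * cnj (coeff p l) * (?w t ^ i * cnj (?w t) ^ l))"
    unfolding sum_product by (simp only: mult_ac)
  also have "\<dots> = (\<Sum>i<N. \<Sum>t<N. \<Sum>l<N. coeff p i * cnj (coeff p l) * (?w t ^ i * cnj (?w t) ^ l))"
    by (rule sum.swap)
  also have "\<dots> = (\<Sum>i<N. \<Sum>l<N. \<Sum>t<N. coeff p i * cnj (coeff p l) * (?w t ^ i * cnj (?w t) ^ l))"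
    by (rule sum.cong[OF refl], rule sum.swap)
  also have "\<dots> = (\<Sum>i<N. \<Sum>l<N. coeff p i * cnj (coeff p l) * (if i = l then of_nat N else 0))"
    unfolding sum_distrib_left[symmetric]
    by (intro sum.cong refl arg_cong2[of _ _ _ _ "(*)"] sum_cis_multiples) auto
  also have "\<dots> = (\<Sum>i<N. coeff p i * cnj (coeff p i) * of_nat N)"
    by (intro sum.cong refl) (simp add: if_distrib sum.delta cong: if_cong)
  also have "\<dots> = of_real (N * (\<Sum>i<N. (norm (coeff p i))\<^sup>2))"
    by (simp only: of_real_mult of_real_sum complex_norm_square sum_distrib_left of_real_of_nat_eq mult.commute)
  finally show ?thesis by (simp only: of_real_eq_iff)
qed

text \<open>Both degrees are below \<open>N\<close>, so Parseval applies to \<open>f\<close> and to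
  the product, and the pointwise bound for \<open>h\<close> passes to coefficient norms.\<close>

lemma coeff_norm_mult_le:
  fixes f h :: "complex poly"
  assumes N: "degree f < N" "degree (f * h) < N"
    and B: "\<And>w. norm w = 1 \<Longrightarrow> (norm (poly h w))\<^sup>2 \<le> B"
  shows "(\<Sum>i<N. (norm (coeff (f * h) i))\<^sup>2) \<le> B * (\<Sum>i<N. (norm (coeff f i))\<^sup>2)"
proof -
  have "N * (\<Sum>i<N. (norm (coeff (f * h) i))\<^sup>2) = (\<Sum>t<N. (norm (poly (f * h) (cis (2 * pi * real t / N))))\<^sup>2)"
    using discrete_parseval[OF N(2)] by simp
  also have "\<dots> \<le> (\<Sum>t<N. B * (norm (poly f (cis (2 * pi * real t / N))))\<^sup>2)"
  proof (rule sum_mono)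
    fix t
    show "(norm (poly (f * h) (cis (2 * pi * real t / N))))\<^sup>2 \<le> B * (norm (poly f (cis (2 * pi * real t / N))))\<^sup>2"
      using mult_right_mono[OF B[of "cis (2 * pi * real t / N)"], of "(norm (poly f (cis (2 * pi * real t / N))))\<^sup>2"]
      by (simp add: norm_mult power_mult_distrib mult.commute)
  qed
  also have "\<dots> = N * (B * (\<Sum>i<N. (norm (coeff f i))\<^sup>2))"
    unfolding sum_distrib_left[symmetric] discrete_parseval[OF N(1)] by (simp add: mult_ac)
  finally show ?thesis using N(1) by (simp add: mult_le_cancel_left_pos)
qed

text \<open>The binomial w^k - \<open>zeta y ^ k\<close> has modulus at most 2 on the circle and 2
  |sin| at \<open>zeta u0\<close>, where it is normalised. A higher power can separate a close pair
  better, at the price of degree \<open>k\<close>.\<close>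

lemma single_node_factor:
  assumes s: "sin (pi * k * \<bar>y - u0\<bar>\<^sub>T) \<noteq> 0"
  obtains f :: "complex poly" where "degree f \<le> k" "poly f (zeta u0) = 1" "poly f (zeta y) = 0"
    "\<And>w. norm w = 1 \<Longrightarrow> (norm (poly f w))\<^sup>2 \<le> 1 / (sin (pi * k * \<bar>y - u0\<bar>\<^sub>T))\<^sup>2"
proof -
  define d where "d = zeta u0 ^ k - zeta y ^ k"
  have nd: "norm d = 2 * \<bar>sin (pi * k * \<bar>y - u0\<bar>\<^sub>T)\<bar>"
    unfolding d_def by (rule norm_zeta_power_diff) (simp add: torus_norm_minus_commute[of y])
  then have d0: "d \<noteq> 0" using s by auto
  define f where "f = Polynomial.smult (1 / d) (monom 1 k - [:zeta y ^ k:])"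
  have f: "poly f w = (w ^ k - zeta y ^ k) / d" for w
    by (simp add: f_def poly_monom)
  show ?thesis
  proof
    show "degree f \<le> k"
      unfolding f_def by (rule order_trans[OF degree_smult_le], rule degree_diff_le) (auto simp: degree_monom_le)
    show "poly f (zeta u0) = 1" using d0 unfolding f by (simp add: d_def)
    show "poly f (zeta y) = 0" unfolding f by simp
    show "(norm (poly f w))\<^sup>2 \<le> 1 / (sin (pi * k * \<bar>y - u0\<bar>\<^sub>T))\<^sup>2" if "norm w = 1" for w
    proof -
      have "norm (w ^ k - zeta y ^ k) \<le> 2"
        using norm_triangle_ineq4[of "w ^ k" "zeta y ^ k"] that by (simp add: norm_power)
      then have "norm (poly f w) \<le> 2 / (2 * \<bar>sin (pi * k * \<bar>y - u0\<bar>\<^sub>T)\<bar>)"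
        unfolding f norm_divide nd by (intro divide_right_mono) auto
      then have "(norm (poly f w))\<^sup>2 \<le> (1 / \<bar>sin (pi * k * \<bar>y - u0\<bar>\<^sub>T)\<bar>)\<^sup>2"
        by (intro power_mono) auto
      then show ?thesis by (simp add: power_divide)
    qed
  qed
qed

text \<open>The degree budget grants a block of size \<open>q\<close> to every near node,
  \<open>u0\<close> included, and floor (2 / \<open>\<tau>\<close>) to every colour of the far
  nodes.\<close>

lemma node_interpolant:
  fixes qy :: "torus \<Rightarrow> nat"
  assumes "finite X" "u0 \<in> X" and \<tau>: "0 < \<tau>" "\<tau> \<le> 1 / 2" and q: "q \<ge> 1"
    and deg: "card (near_set u0 \<tau> X) * q + local_sparsity \<tau> (far_set u0 \<tau> X) * nat \<lfloor>2 / \<tau>\<rfloor> \<le> m"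
    and qy: "\<And>y. y \<in> near_set u0 \<tau> X - {u0} \<Longrightarrow> qy y \<le> q"
    and sin: "\<And>y. y \<in> near_set u0 \<tau> X - {u0} \<Longrightarrow> sin (pi * qy y * \<bar>y - u0\<bar>\<^sub>T) \<noteq> 0"
  obtains p :: "complex poly" where "degree p < m" "poly p (zeta u0) = 1"
    "\<And>u. \<lbrakk>u \<in> X; u \<noteq> u0\<rbrakk> \<Longrightarrow> poly p (zeta u) = 0"
    "(\<Sum>i<m. (norm (coeff p i))\<^sup>2) \<le> 2 ^ local_sparsity \<tau> (far_set u0 \<tau> X) / q *
       (\<Prod>y\<in>near_set u0 \<tau> X - {u0}. 1 / (sin (pi * qy y * \<bar>y - u0\<bar>\<^sub>T))\<^sup>2)"
proof -
  define Y where "Y = near_set u0 \<tau> X - {u0}"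
  define G where "G = far_set u0 \<tau> X"
  define \<nu> where "\<nu> = local_sparsity \<tau> G"
  define b where "b = (\<lambda>y. 1 / (sin (pi * qy y * \<bar>y - u0\<bar>\<^sub>T))\<^sup>2)"
  have fin: "finite Y" "finite G" using \<open>finite X\<close> by (auto simp: Y_def G_def near_set_def far_set_def)
  have near: "near_set u0 \<tau> X = insert u0 Y" "u0 \<notin> Y"
    using \<open>u0 \<in> X\<close> \<tau> by (auto simp: Y_def near_set_def)
  then have cardY: "card (near_set u0 \<tau> X) = Suc (card Y)" using fin by simp
  obtain g :: "complex poly" where g: "degree g \<le> \<nu> * nat \<lfloor>2 / \<tau>\<rfloor>" "poly g (zeta u0) = 1"
    "\<And>u. u \<in> G \<Longrightarrow> poly g (zeta u) = 0"
    "\<And>w. norm w = 1 \<Longrightarrow> (norm (poly g w))\<^sup>2 \<le> 2 ^ \<nu>"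
  proof (rule far_interpolant[OF fin(2) \<tau>, of u0])
    show "\<tau> < \<bar>u - u0\<bar>\<^sub>T" if "u \<in> G" for u
      using that by (simp add: G_def far_set_def torus_norm_minus_commute)
  qed (auto simp: \<nu>_def)
  have "\<exists>f :: complex poly. degree f \<le> qy y \<and> poly f (zeta u0) = 1 \<and> poly f (zeta y) = 0 \<and>
    (\<forall>w. norm w = 1 \<longrightarrow> (norm (poly f w))\<^sup>2 \<le> b y)" if "y \<in> Y" for y
    using single_node_factor[of "qy y" y u0] sin[of y] that unfolding b_def Y_def by metis
  then obtain f :: "torus \<Rightarrow> complex poly" where f: "\<And>y. y \<in> Y \<Longrightarrow> degree (f y) \<le> qy y"
    "\<And>y. y \<in> Y \<Longrightarrow> poly (f y) (zeta u0) = 1" "\<And>y. y \<in> Y \<Longrightarrow> poly (f y) (zeta y) = 0"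
    "\<And>y w. \<lbrakk>y \<in> Y; norm w = 1\<rbrakk> \<Longrightarrow> (norm (poly (f y) w))\<^sup>2 \<le> b y"
    by metis
  define h where "h = (\<Prod>y\<in>Y. f y) * g"
  \<comment> \<open>The averaged geometric sum takes the value 1 at \<open>zeta u0\<close>; its
    \<open>q\<close> coefficients have modulus 1 / q, so their squares sum to 1 / q only.\<close>
  define D where "D = (\<Sum>j<q. monom (cnj (zeta u0) ^ j / of_nat q) j)"
  have coeffD: "coeff D i = (if i < q then cnj (zeta u0) ^ i / of_nat q else 0)" for i
    unfolding D_def coeff_sum coeff_monom by (simp add: sum.delta)
  have degD: "degree D \<le> q - 1"
    by (rule degree_le) (auto simp: coeffD)
  have degh: "degree h \<le> card Y * q + \<nu> * nat \<lfloor>2 / \<tau>\<rfloor>"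
  proof -
    have "degree (\<Prod>y\<in>Y. f y) \<le> (\<Sum>y\<in>Y. degree (f y))"
      using degree_prod_sum_le[OF fin(1), of f] by (simp add: comp_def)
    also have "\<dots> \<le> (\<Sum>y\<in>Y. q)"
      using f(1) qy unfolding Y_def by (intro sum_mono) (meson order_trans)
    finally show ?thesis
      unfolding h_def using g(1) degree_mult_le[of "\<Prod>y\<in>Y. f y" g] by simp
  qed
  have "degree (D * h) \<le> degree D + degree h" by (rule degree_mult_le)
  \<comment> \<open>The block of \<open>u0\<close> itself is filled by \<open>D\<close>, of degree
    at most q - 1; this one spare degree makes the inequality with \<open>m\<close> strict.\<close>
  also have "\<dots> \<le> (q - 1) + (card Y * q + \<nu> * nat \<lfloor>2 / \<tau>\<rfloor>)" using degD degh by simp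
  also have "\<dots> < m" using deg q unfolding cardY G_def[symmetric] \<nu>_def[symmetric] by simp
  finally have degDh: "degree (D * h) < m" .
  have qm: "q \<le> m" using deg unfolding cardY by simp
  then have degDm: "degree D < m" using degD q by simp
  have h1: "poly h (zeta u0) = 1" unfolding h_def using f(2) g(2) by (simp add: poly_prod)
  have normD: "(\<Sum>i<m. (norm (coeff D i))\<^sup>2) = 1 / q"
  proof -
    have "(\<Sum>i<m. (norm (coeff D i))\<^sup>2) = (\<Sum>i<q. (1 / real q)\<^sup>2)"
      by (rule sum.mono_neutral_cong_right) (use qm in \<open>auto simp: coeffD norm_divide norm_power\<close>)
    also have "\<dots> = 1 / q" using q by (simp add: power2_eq_square)
    finally show ?thesis .
  qed
  have boundh: "(norm (poly h w))\<^sup>2 \<le> (\<Prod>y\<in>Y. b y) * 2 ^ \<nu>" if w: "norm w = 1" for w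
  proof -
    have "(norm (poly h w))\<^sup>2 = (\<Prod>y\<in>Y. (norm (poly (f y) w))\<^sup>2) * (norm (poly g w))\<^sup>2"
      unfolding h_def poly_mult poly_prod norm_mult power_mult_distrib prod_norm[symmetric] prod_power_distrib ..
    also have "\<dots> \<le> (\<Prod>y\<in>Y. b y) * 2 ^ \<nu>"
      using f(4) g(4) w by (intro mult_mono prod_mono prod_nonneg) (auto simp: b_def)
    finally show ?thesis .
  qed
  show ?thesis
  proof
    show "degree (D * h) < m" by (rule degDh)
    have "poly D (zeta u0) = (\<Sum>j<q. (zeta u0 * cnj (zeta u0)) ^ j / of_nat q)"
      unfolding D_def poly_sum poly_monom by (simp add: power_mult_distrib mult.commute)
    also have "\<dots> = 1"
      using q by (simp add: zeta_diff[symmetric] zeta_abs_torus zero_torus_def)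
    finally show "poly (D * h) (zeta u0) = 1" using h1 by simp
    show "poly (D * h) (zeta u) = 0" if u: "u \<in> X" "u \<noteq> u0" for u
    proof -
      have "u \<in> Y \<or> u \<in> G"
        using u by (auto simp: Y_def G_def near_set_def far_set_def)
      then show ?thesis
        unfolding h_def poly_mult poly_prod using f(3) g(3) fin by auto
    qed
    show "(\<Sum>i<m. (norm (coeff (D * h) i))\<^sup>2) \<le> 2 ^ local_sparsity \<tau> (far_set u0 \<tau> X) / q *
       (\<Prod>y\<in>near_set u0 \<tau> X - {u0}. 1 / (sin (pi * qy y * \<bar>y - u0\<bar>\<^sub>T))\<^sup>2)"
      using coeff_norm_mult_le[OF degDm degDh boundh]
      unfolding normD Y_def[symmetric] G_def[symmetric] \<nu>_def[symmetric] b_def by (simp add: mult_ac)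
  qed
qed


section \<open>Singular values of Fourier matrices\<close>

text \<open>The characteristic polynomial splits over the complex numbers, so the list has exactly
  \<open>s\<close> entries and position k - 1 is in range; the entry found there comes from a root,
  hence from an eigenvector.\<close>

lemma singular_value_eigenvector:
  assumes A: "A \<in> carrier_mat m s" and k: "1 \<le> k" "k \<le> s"
  obtains z v where "singular_value k A = sqrt (Re z)" "v \<in> carrier_vec s" "v \<noteq> 0\<^sub>v s"
    "(mat_adjoint A * A) *\<^sub>v v = z \<cdot>\<^sub>v v"
proof -
  define B where "B = mat_adjoint A * A"
  have "mat_adjoint A \<in> carrier_mat s m"
    using A unfolding mat_adjoint_def by auto
  then have B: "B \<in> carrier_mat s s" using A by (simp add: B_def)
  have deg: "degree (char_poly B) = s" "monic (char_poly B)"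
    using degree_monic_char_poly[OF B] by auto
  have "length (singular_values A) = size (proots (char_poly B))"
    unfolding singular_values_def B_def by (metis length_rev mset_sorted_list_of_multiset size_image_mset size_mset)
  then have len: "length (singular_values A) = s"
    by (simp add: size_proots_complex deg)
  then have "singular_value k A \<in> set (singular_values A)"
    unfolding singular_value_def using k by (intro nth_mem) auto
  also have "\<dots> = (\<lambda>z. sqrt (Re z)) ` set_mset (proots (char_poly B))"
    unfolding singular_values_def B_def by simp
  finally obtain z where z: "z \<in># proots (char_poly B)" "singular_value k A = sqrt (Re z)" by auto
  have "char_poly B \<noteq> 0" using deg by auto
  then have "poly (char_poly B) z = 0" using z(1) by simp
  then have "eigenvalue B z" using eigenvalue_root_char_poly[OF B] by simp
  then obtain v where "v \<in> carrier_vec s" "v \<noteq> 0\<^sub>v s" "B *\<^sub>v v = z \<cdot>\<^sub>v v"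
    unfolding eigenvalue_def eigenvector_def using B by auto
  then show ?thesis using that z(2) by (simp add: B_def)
qed

lemma mat_adjoint_mult_vec_index:
  assumes A: "A \<in> carrier_mat m s" and v: "v \<in> carrier_vec s" and i: "i < s"
  shows "((mat_adjoint A * A) *\<^sub>v v) $ i = (\<Sum>j<m. cnj (A $$ (j, i)) * (\<Sum>l<s. A $$ (j, l) * v $ l))"
proof -
  have adj: "mat_adjoint A \<in> carrier_mat s m"
    using A unfolding mat_adjoint_def by auto
  have Av: "A *\<^sub>v v \<in> carrier_vec m" using A v by simp
  have "((mat_adjoint A * A) *\<^sub>v v) $ i = (mat_adjoint A *\<^sub>v (A *\<^sub>v v)) $ i"
    using assoc_mult_mat_vec[OF adj A v] by simp
  also have "\<dots> = (\<Sum>j<m. mat_adjoint A $$ (i, j) * (A *\<^sub>v v) $ j)"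
    using adj A i by (simp add: scalar_prod_def atLeast0LessThan)
  also have "\<dots> = (\<Sum>j<m. cnj (A $$ (j, i)) * (\<Sum>l<s. A $$ (j, l) * v $ l))"
  proof (rule sum.cong[OF refl])
    fix j assume j: "j \<in> {..<m}"
    have "mat_adjoint A $$ (i, j) = cnj (A $$ (j, i))"
      using A i j unfolding mat_adjoint_def by (simp add: mat_of_rows_index)
    moreover have "(A *\<^sub>v v) $ j = (\<Sum>l<s. A $$ (j, l) * v $ l)"
      using A v j by (simp add: scalar_prod_def atLeast0LessThan)
    ultimately show "mat_adjoint A $$ (i, j) * (A *\<^sub>v v) $ j = cnj (A $$ (j, i)) * (\<Sum>l<s. A $$ (j, l) * v $ l)"
      by simp
  qed
  finally show ?thesis .
qed

text \<open>Duality: the coefficients of \<open>p k\<close> paired with the image of an eigenvector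
  return its \<open>k\<close>-th coordinate. Cauchy-Schwarz then bounds the squared norm of the
  eigenvector by \<open>T\<close> times that of its image.\<close>

lemma singular_value_fourier_matrix_bound:
  fixes p :: "nat \<Rightarrow> complex poly"
  assumes s: "s \<ge> 1"
    and deg: "\<And>k. k \<in> {1..s} \<Longrightarrow> degree (p k) < m"
    and val: "\<And>k l. \<lbrakk>k \<in> {1..s}; l \<in> {1..s}\<rbrakk> \<Longrightarrow> poly (p k) (zeta (x l)) = (if l = k then 1 else 0)"
  defines "\<sigma> \<equiv> singular_value s (fourier_matrix m s x)"
  shows "\<sigma> > 0" and "1 / \<sigma>\<^sup>2 \<le> (\<Sum>k=1..s. \<Sum>i<m. (norm (coeff (p k) i))\<^sup>2)"
proof -
  define T where "T = (\<Sum>k=1..s. \<Sum>i<m. (norm (coeff (p k) i))\<^sup>2)"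
  define A where "A = fourier_matrix m s x"
  have A: "A \<in> carrier_mat m s" by (simp add: A_def fourier_matrix_def)
  have Aij: "A $$ (j, l) = zeta (x (l + 1)) ^ j" if "j < m" "l < s" for j l
    using that by (simp add: A_def fourier_matrix_def torus_char_power)
  obtain z v where z: "\<sigma> = sqrt (Re z)" and v: "v \<in> carrier_vec s" "v \<noteq> 0\<^sub>v s"
    and ev: "(mat_adjoint A * A) *\<^sub>v v = z \<cdot>\<^sub>v v"
    using singular_value_eigenvector[OF A s order_refl] unfolding \<sigma>_def A_def by blast
  define y where "y = (\<lambda>j. \<Sum>l<s. A $$ (j, l) * v $ l)"
  define V where "V = (\<Sum>i<s. (norm (v $ i))\<^sup>2)"
  define Y where "Y = (\<Sum>j<m. (norm (y j))\<^sup>2)"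
  \<comment> \<open>Rayleigh quotient: \<open>V\<close> and \<open>Y\<close> are the squared norms
    of the eigenvector and of its image under \<open>A\<close>.\<close>
  have zV: "z * of_real V = of_real Y"
  proof -
    have "z * of_real V = (\<Sum>i<s. cnj (v $ i) * (z \<cdot>\<^sub>v v) $ i)"
      unfolding V_def of_real_sum complex_norm_square sum_distrib_left
      using v(1) by (intro sum.cong) (auto simp: mult_ac)
    also have "\<dots> = (\<Sum>i<s. \<Sum>j<m. cnj (A $$ (j, i) * v $ i) * y j)"
      unfolding ev[symmetric] using mat_adjoint_mult_vec_index[OF A v(1)]
      by (intro sum.cong) (auto simp: y_def sum_distrib_left mult_ac)
    also have "\<dots> = (\<Sum>j<m. \<Sum>i<s. cnj (A $$ (j, i) * v $ i) * y j)"
      by (rule sum.swap)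
    also have "\<dots> = (\<Sum>j<m. y j * cnj (y j))"
      unfolding sum_distrib_right[symmetric] cnj_sum[symmetric] y_def by (simp add: mult.commute)
    also have "\<dots> = of_real Y"
      unfolding Y_def by (simp only: of_real_sum complex_norm_square)
    finally show ?thesis .
  qed
  have V: "V > 0"
  proof -
    obtain i where "i < s" "v $ i \<noteq> 0" using v by (metis carrier_vecD eq_vecI index_zero_vec)
    then have "0 < (norm (v $ i))\<^sup>2" "(norm (v $ i))\<^sup>2 \<le> V"
      unfolding V_def by (auto intro!: member_le_sum)
    then show ?thesis by linarith
  qed
  \<comment> \<open>Vector entries are counted from 0 and nodes from 1, hence the shift to
    \<open>p (k + 1)\<close>.\<close>
  have vk: "(norm (v $ k))\<^sup>2 \<le> (\<Sum>i<m. (norm (coeff (p (k + 1)) i))\<^sup>2) * Y" if k: "k < s" for k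
  proof -
    have "(\<Sum>j<m. coeff (p (k + 1)) j * y j) = (\<Sum>j<m. \<Sum>l<s. coeff (p (k + 1)) j * zeta (x (l + 1)) ^ j * v $ l)"
      unfolding y_def by (simp add: Aij sum_distrib_left mult_ac)
    also have "\<dots> = (\<Sum>l<s. poly (p (k + 1)) (zeta (x (l + 1))) * v $ l)"
      using k deg[of "k + 1"] unfolding sum.swap[of _ "{..<s}"]
      by (simp add: poly_eq_sum_lessThan[of _ m] sum_distrib_right)
    also have "\<dots> = (\<Sum>l<s. if l = k then v $ l else 0)"
      using k by (intro sum.cong) (auto simp: val)
    also have "\<dots> = v $ k" using k by simp
    finally have "norm (v $ k) = norm (\<Sum>j<m. coeff (p (k + 1)) j * y j)" by simp
    also have "\<dots> \<le> (\<Sum>j<m. norm (coeff (p (k + 1)) j) * norm (y j))"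
      unfolding norm_mult[symmetric] by (rule norm_sum)
    finally have "(norm (v $ k))\<^sup>2 \<le> (\<Sum>j<m. norm (coeff (p (k + 1)) j) * norm (y j))\<^sup>2"
      by (intro power_mono) auto
    also have "\<dots> \<le> (\<Sum>i<m. (norm (coeff (p (k + 1)) i))\<^sup>2) * Y"
      unfolding Y_def by (rule Cauchy_Schwarz_ineq_sum)
    finally show ?thesis .
  qed
  have "V \<le> (\<Sum>k<s. (\<Sum>i<m. (norm (coeff (p (k + 1)) i))\<^sup>2) * Y)"
    unfolding V_def using vk by (intro sum_mono) auto
  also have "\<dots> = T * Y"
    unfolding T_def sum_distrib_right[symmetric]
    by (simp add: sum.atLeast1_atMost_eq lessThan_Suc_eq_insert_0 atLeast0LessThan)
  finally have VTY: "V \<le> T * Y" .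
  have "Re (z * of_real V) = Y" unfolding zV by simp
  then have "Re z * V = Y" by simp
  then have "V * 1 \<le> V * (T * Re z)" using VTY by (simp add: mult_ac)
  then have TR: "1 \<le> T * Re z" using V by (simp only: mult_le_cancel_left_pos)
  have "T \<ge> 0" unfolding T_def by (intro sum_nonneg) auto
  \<comment> \<open>Positivity is a by-product: a nonpositive eigenvalue would contradict
    \<open>TR\<close>.\<close>
  then have R: "Re z > 0" using TR
    by (metis linorder_not_le mult_nonneg_nonpos not_one_le_zero order_trans)
  then show "\<sigma> > 0" unfolding z by simp
  have "\<sigma>\<^sup>2 = Re z" unfolding z using R by simp
  then show "1 / \<sigma>\<^sup>2 \<le> (\<Sum>k=1..s. \<Sum>i<m. (norm (coeff (p k) i))\<^sup>2)"
    using TR R unfolding T_def[symmetric] by (simp add: divide_le_eq)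
qed


section \<open>Products of sines over separated points\<close>

text \<open>Concavity of the sine on [0, pi] along the segment from 0 to \<open>y\<close>. Taking
  \<open>y\<close> = pi / 2 gives Jordan's inequality, stated next.\<close>

lemma sin_scaled_ge:
  assumes "0 \<le> c" "c \<le> 1" "0 \<le> y" "y \<le> pi"
  shows "c * sin y \<le> sin (c * y)"
proof -
  have "concave_on {0..pi} sin"
  proof (rule f''_le0_imp_concave)
    show "(cos has_real_derivative - sin x) (at x)" for x
      by (auto intro!: derivative_eq_intros)
    show "(sin has_real_derivative cos x) (at x)" for x
      by (auto intro!: derivative_eq_intros)
    show "- sin x \<le> 0" if "x \<in> {0..pi}" for x
      using that by (simp add: sin_ge_zero)
  qed simp
  then show ?thesis
    using concave_onD[of "{0..pi}" sin c 0 y] assms by simp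
qed

lemma sin_pi_times_ge:
  assumes "0 \<le> x" "x \<le> 1 / 2"
  shows "2 * x \<le> sin (pi * x)"
  using sin_scaled_ge[of "2 * x" "pi / 2"] assms by (simp add: mult.commute)

text \<open>Cleared form of (1 + 1/N)^(2N) (N + 2)/(N + 1) <= e^2, the induction step for
  \<open>fact_squared_ge\<close>. The trapezoid bound for the logarithm leaves a surplus of exactly
  1 / (N + 1), which pays for the second quotient.\<close>

lemma one_plus_inverse_power_le:
  assumes "N \<ge> (1::nat)"
  shows "(real N + 2) * (real N + 1) ^ (2 * N) \<le> (exp 1)\<^sup>2 * ((real N + 1) * real N ^ (2 * N))"
proof -
  have N: "real N > 0" using assms by simp
  define a where "a = (real N + 1) / N"
  define b where "b = (real N + 2) / (real N + 1)"
  have pos: "a > 0" "b > 0" using N by (auto simp: a_def b_def)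
  have "ln a \<le> (inverse (real N) + inverse (real N + 1)) / 2"
    using ln_inverse_approx_le[OF N, of 1] N by (simp add: a_def ln_div)
  then have "2 * N * ln a \<le> 2 * N * ((inverse (real N) + inverse (real N + 1)) / 2)"
    using N by (intro mult_left_mono) auto
  also have "\<dots> = 1 + real N / (real N + 1)"
    using N by (simp add: distrib_left inverse_eq_divide)
  also have "real N / (real N + 1) = 1 - 1 / (real N + 1)"
    using N by (simp add: field_simps)
  finally have "2 * N * ln a \<le> 2 - 1 / (real N + 1)" by simp
  moreover have "ln b \<le> 1 / (real N + 1)"
  proof -
    have "b = 1 + 1 / (real N + 1)" using N by (simp add: b_def field_simps)
    then show ?thesis using ln_add_one_self_le_self[of "1 / (real N + 1)"] by simp
  qed
  ultimately have "real (2 * N) * ln a + ln b \<le> 2" by simp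
  moreover have "real (2 * N) * ln a + ln b = ln (a ^ (2 * N) * b)"
    using pos by (simp add: ln_mult ln_realpow)
  ultimately have "a ^ (2 * N) * b \<le> exp 2"
    using pos by (metis exp_le_cancel_iff exp_ln mult_pos_pos zero_less_power)
  moreover have "exp 2 = (exp 1 :: real)\<^sup>2" by (simp add: exp_of_nat_mult[symmetric] power2_eq_square exp_add[symmetric])
  moreover have "a ^ (2 * N) * b = (real N + 1) ^ (2 * N) * (real N + 2) / (real N ^ (2 * N) * (real N + 1))"
    unfolding a_def b_def by (simp add: power_divide)
  ultimately have "(real N + 1) ^ (2 * N) * (real N + 2) / (real N ^ (2 * N) * (real N + 1)) \<le> (exp 1)\<^sup>2" by simp
  then show ?thesis using N by (simp add: pos_divide_le_eq mult_ac)
qed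

text \<open>A Stirling-type bound by induction; the constant is fixed by equality at N = 1.\<close>

lemma fact_squared_ge:
  assumes "N \<ge> (1::nat)"
  shows "(exp 1)\<^sup>2 / 2 * (real N + 1) * (real N / exp 1) ^ (2 * N) \<le> (fact N)\<^sup>2"
  using assms
proof (induction N rule: nat_induct_at_least)
  case base
  then show ?case by (simp add: power_divide)
next
  case (Suc N)
  define e :: real where "e = exp 1"
  have e: "e > 0" by (simp add: e_def)
  have "e\<^sup>2 / 2 * (real (Suc N) + 1) * (real (Suc N) / e) ^ (2 * Suc N)
     = (real N + 1)\<^sup>2 / e ^ (2 * N) / 2 * ((real N + 2) * (real N + 1) ^ (2 * N))"
    using e by (simp add: power_divide power_add power2_eq_square field_simps)
  also have "\<dots> \<le> (real N + 1)\<^sup>2 / e ^ (2 * N) / 2 * (e\<^sup>2 * ((real N + 1) * real N ^ (2 * N)))"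
    using one_plus_inverse_power_le[OF Suc.hyps] e unfolding e_def[symmetric] by (intro mult_left_mono) auto
  also have "\<dots> = (real N + 1)\<^sup>2 * (e\<^sup>2 / 2 * (real N + 1) * (real N / e) ^ (2 * N))"
    by (simp add: power_divide)
  also have "\<dots> \<le> (real N + 1)\<^sup>2 * (fact N)\<^sup>2"
    using Suc.IH unfolding e_def by (intro mult_left_mono) auto
  also have "\<dots> = (fact (Suc N))\<^sup>2"
    by (simp add: power_mult_distrib add.commute)
  finally show ?case unfolding e_def .
qed

lemma e_ge_27: "(27 / 10 :: real) \<le> exp 1"
  using e_approx_32 by (simp add: abs_if split: if_splits)

lemma pi_le_half_e_squared: "pi \<le> (exp 1)\<^sup>2 / 2"
proof -
  have "(27 / 10 :: real)\<^sup>2 \<le> (exp 1)\<^sup>2" using e_ge_27 by (rule power_mono) simp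
  moreover have "pi \<le> 32 / 10" using pi_approx by simp
  ultimately show ?thesis by (simp add: power2_eq_square)
qed

lemma prod_double_even: "(\<Prod>j<2 * p. real (j div 2 + 1)) = (fact p)\<^sup>2"
  by (induction p) (simp_all add: power2_eq_square algebra_simps)

text \<open>The product is 1 1 2 2 3 3 ..., so it equals p!^2 or (p + 1)!^2 / (p + 1) according to
  parity. The factor pi is afforded by pi <= e^2 / 2.\<close>

lemma prod_half_ge: "pi * (real (n + 1) / (2 * exp 1)) ^ (n + 1) \<le> (\<Prod>j<n. real (j div 2 + 1))"
proof -
  define e :: real where "e = exp 1"
  have e: "e > 0" "e \<ge> 27 / 10" "pi \<le> e\<^sup>2 / 2"
    using e_ge_27 pi_le_half_e_squared by (auto simp: e_def)
  have fact: "e\<^sup>2 / 2 * (real N + 1) * (real N / e) ^ (2 * N) \<le> (fact N)\<^sup>2" if "N \<ge> 1" for N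
    using fact_squared_ge[OF that] by (simp add: e_def)
  consider "n = 0" | p where "p \<ge> 1" "n = 2 * p" | p where "n = 2 * p + 1"
    by (metis One_nat_def Suc_leI evenE gr0I mult_0_right oddE)
  then have "pi * (real (n + 1) / (2 * e)) ^ (n + 1) \<le> (\<Prod>j<n. real (j div 2 + 1))"
  proof cases
    case 1
    have "pi \<le> 2 * e" using pi_less_4 e by simp
    then show ?thesis using 1 e by simp
  next
    case (2 p)
    have p: "real p > 0" using 2 by simp
    \<comment> \<open>Replacing p + 1/2 by p in the power costs one factor e, which the odd exponent
      2 p + 1 of 1 / e supplies.\<close>
    have "(1 + 1 / (2 * real p)) ^ (2 * p) \<le> e"
      using exp_ge_one_plus_x_over_n_power_n[of "2 * p" 1] p by (simp add: e_def)
    then have "((real p + 1 / 2) / real p) ^ (2 * p) \<le> e"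
      using p by (simp add: add_divide_distrib)
    then have *: "(real p + 1 / 2) ^ (2 * p) \<le> e * real p ^ (2 * p)"
      using p by (simp add: power_divide pos_divide_le_eq)
    have "pi * (real (n + 1) / (2 * e)) ^ (n + 1) = pi * ((real p + 1 / 2) / e) ^ (2 * p + 1)"
      unfolding 2 by (simp add: add_divide_distrib add.commute)
    also have "\<dots> = pi * (real p + 1 / 2) / e ^ (2 * p + 1) * (real p + 1 / 2) ^ (2 * p)"
      by (simp add: power_divide)
    also have "\<dots> \<le> pi * (real p + 1 / 2) / e ^ (2 * p + 1) * (e * real p ^ (2 * p))"
      using e by (intro mult_left_mono[OF *]) simp
    also have "\<dots> = pi * (real p + 1 / 2) * (real p / e) ^ (2 * p)"
      using e by (simp add: power_divide)
    also have "\<dots> \<le> e\<^sup>2 / 2 * (real p + 1) * (real p / e) ^ (2 * p)"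
      using e by (intro mult_right_mono mult_mono) auto
    also have "\<dots> \<le> (fact p)\<^sup>2" using fact 2 by simp
    finally show ?thesis unfolding 2 prod_double_even .
  next
    case (3 p)
    define N where "N = p + 1"
    have N: "N \<ge> 1" by (simp add: N_def)
    have "pi * (real (n + 1) / (2 * e)) ^ (n + 1) = pi * (real N / e) ^ (2 * N)"
      unfolding 3 N_def by (simp add: add_divide_distrib)
    also have "\<dots> \<le> (e\<^sup>2 / 2 * (real N + 1) * (real N / e) ^ (2 * N)) / N"
    proof -
      have "pi * N \<le> e\<^sup>2 / 2 * (real N + 1)" using e N by (intro mult_mono) auto
      then have "(pi * N) * (real N / e) ^ (2 * N) \<le> (e\<^sup>2 / 2 * (real N + 1)) * (real N / e) ^ (2 * N)"
        using e by (intro mult_right_mono) auto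
      then show ?thesis using N by (simp add: pos_le_divide_eq mult_ac)
    qed
    also have "\<dots> \<le> (fact N)\<^sup>2 / N"
      using fact[OF N] by (intro divide_right_mono) auto
    also have "\<dots> = (\<Prod>j<n. real (j div 2 + 1))"
      unfolding 3 N_def using prod_double_even[of p] by (simp add: power2_eq_square)
    finally show ?thesis .
  qed
  then show ?thesis unfolding e_def .
qed

text \<open>Distinct points lie in distinct cells of length \<open>\<delta>\<close>, and the cell
  starting at 0 is empty.\<close>

lemma card_separated_le:
  fixes \<delta> L :: real
  assumes "finite S" "\<delta> > 0" "L \<ge> 0"
    and "\<And>t. t \<in> S \<Longrightarrow> \<delta> \<le> t \<and> t \<le> L"
    and "\<And>t u. \<lbrakk>t \<in> S; u \<in> S; t \<noteq> u\<rbrakk> \<Longrightarrow> \<delta> \<le> \<bar>t - u\<bar>"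
  shows "card S \<le> nat \<lfloor>L / \<delta>\<rfloor>"
proof -
  have "inj_on (\<lambda>t. \<lfloor>t / \<delta>\<rfloor>) S"
  proof (rule inj_onI, rule ccontr)
    fix t u assume tu: "t \<in> S" "u \<in> S" "\<lfloor>t / \<delta>\<rfloor> = \<lfloor>u / \<delta>\<rfloor>" "t \<noteq> u"
    then have "real_of_int \<lfloor>t / \<delta>\<rfloor> = real_of_int \<lfloor>u / \<delta>\<rfloor>" by simp
    then have "\<bar>t / \<delta> - u / \<delta>\<bar> < 1"
      using of_int_floor_le[of "t / \<delta>"] of_int_floor_le[of "u / \<delta>"]
        real_of_int_floor_add_one_gt[of "t / \<delta>"] real_of_int_floor_add_one_gt[of "u / \<delta>"]
      by linarith
    then have "\<bar>t - u\<bar> < \<delta>"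
      using \<open>\<delta> > 0\<close> by (simp add: diff_divide_distrib[symmetric] abs_divide pos_divide_less_eq)
    then show False using assms(5)[OF tu(1,2,4)] by simp
  qed
  moreover have "(\<lambda>t. \<lfloor>t / \<delta>\<rfloor>) ` S \<subseteq> {1..\<lfloor>L / \<delta>\<rfloor>}"
  proof
    fix k assume "k \<in> (\<lambda>t. \<lfloor>t / \<delta>\<rfloor>) ` S"
    then obtain t where t: "t \<in> S" "k = \<lfloor>t / \<delta>\<rfloor>" by blast
    have "1 \<le> t / \<delta>" "t / \<delta> \<le> L / \<delta>"
      using assms(4)[OF t(1)] assms(2) by (simp_all add: divide_right_mono)
    then show "k \<in> {1..\<lfloor>L / \<delta>\<rfloor>}" unfolding t(2) using floor_mono[of "t / \<delta>" "L / \<delta>"] by (simp add: one_le_floor)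
  qed
  ultimately have "card S \<le> card {1..\<lfloor>L / \<delta>\<rfloor>}"
    by (intro card_inj_on_le) auto
  then show ?thesis by simp
qed

text \<open>Points may lie on both sides of the origin, so the farthest of j + 1 points has distance
  at least (j div 2 + 1) \<open>\<delta>\<close>; the induction splits it off. The hypothesis on
  \<open>f\<close> is limited to multiples that can occur, since the sine estimate is only available
  for those.\<close>

lemma prod_separated_ge:
  fixes f :: "real \<Rightarrow> real" and \<delta> \<kappa> :: real
  assumes "finite S" "\<delta> > 0" "\<kappa> \<ge> 0"
    and "\<And>t. t \<in> S \<Longrightarrow> \<delta> \<le> \<bar>t\<bar>"
    and "\<And>t u. \<lbrakk>t \<in> S; u \<in> S; t \<noteq> u\<rbrakk> \<Longrightarrow> \<delta> \<le> \<bar>t - u\<bar>"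
    and "\<And>t i. \<lbrakk>t \<in> S; i \<le> (card S + 1) div 2; i * \<delta> \<le> \<bar>t\<bar>\<rbrakk> \<Longrightarrow> \<kappa> * real i \<le> f t"
  shows "\<kappa> ^ card S * (\<Prod>j<card S. real (j div 2 + 1)) \<le> (\<Prod>t\<in>S. f t)"
  using assms(1,4,5,6)
proof (induction "card S" arbitrary: S)
  case 0
  then show ?case by simp
next
  case (Suc n)
  have "S \<noteq> {}" using Suc.hyps(2) by auto
  then have "Max (abs ` S) \<in> abs ` S" using Suc.prems(1) by (intro Max_in) auto
  then obtain t0 where t0: "t0 \<in> S" "\<bar>t0\<bar> = Max (abs ` S)" by force
  have max: "\<bar>t\<bar> \<le> \<bar>t0\<bar>" if "t \<in> S" for t
    unfolding t0(2) using Suc.prems(1) that by auto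
  define k where "k = nat \<lfloor>\<bar>t0\<bar> / \<delta>\<rfloor>"
  have "card {t \<in> S. t > 0} \<le> k"
    unfolding k_def
  proof (rule card_separated_le)
    fix t assume "t \<in> {t \<in> S. t > 0}"
    then show "\<delta> \<le> t \<and> t \<le> \<bar>t0\<bar>" using Suc.prems(2)[of t] max[of t] by simp
  qed (use Suc.prems assms(2) in auto)
  moreover have "card (uminus ` {t \<in> S. t < 0}) \<le> k"
    unfolding k_def
  proof (rule card_separated_le)
    fix t assume "t \<in> uminus ` {t \<in> S. t < 0}"
    then obtain u where "u \<in> S" "u < 0" "t = - u" by auto
    then show "\<delta> \<le> t \<and> t \<le> \<bar>t0\<bar>" using Suc.prems(2)[of u] max[of u] by simp
  next
    fix t u assume "t \<in> uminus ` {t \<in> S. t < 0}" "u \<in> uminus ` {t \<in> S. t < 0}" "t \<noteq> u"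
    then obtain t' u' where "t' \<in> S" "u' \<in> S" "t = - t'" "u = - u'" "t' \<noteq> u'" by auto
    then show "\<delta> \<le> \<bar>t - u\<bar>" using Suc.prems(3)[of t' u'] by (simp add: abs_minus_commute)
  qed (use Suc.prems assms(2) in auto)
  moreover have "card (uminus ` {t \<in> S. t < 0}) = card {t \<in> S. t < 0}"
    by (intro card_image) auto
  moreover have "card S = card {t \<in> S. t > 0} + card {t \<in> S. t < 0}"
  proof -
    have "S = {t \<in> S. t > 0} \<union> {t \<in> S. t < 0}"
      using Suc.prems(2) assms(2) by (auto simp: not_less_iff_gr_or_eq) fastforce
    then have "card S = card ({t \<in> S. t > 0} \<union> {t \<in> S. t < 0})" by simp
    also have "\<dots> = card {t \<in> S. t > 0} + card {t \<in> S. t < 0}"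
      using Suc.prems(1) by (intro card_Un_disjoint) auto
    finally show ?thesis .
  qed
  ultimately have "Suc n \<le> 2 * k" using Suc.hyps(2) by linarith
  then have "n div 2 + 1 \<le> k" by linarith
  then have "real (n div 2 + 1) \<le> \<bar>t0\<bar> / \<delta>"
    unfolding k_def using assms(2) by (simp add: le_nat_iff le_floor_iff)
  then have "real (n div 2 + 1) * \<delta> \<le> \<bar>t0\<bar>"
    using assms(2) by (simp only: pos_le_divide_eq)
  moreover have "n div 2 + 1 \<le> (card S + 1) div 2" unfolding Suc.hyps(2)[symmetric] by simp
  ultimately have f0: "\<kappa> * real (n div 2 + 1) \<le> f t0"
    by (intro Suc.prems(4)[OF t0(1)])
  have card: "card (S - {t0}) = n" using Suc.hyps(2) Suc.prems(1) t0(1) by simp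
  have IH: "\<kappa> ^ n * (\<Prod>j<n. real (j div 2 + 1)) \<le> (\<Prod>t\<in>S - {t0}. f t)"
  proof (rule Suc.hyps(1)[of "S - {t0}", unfolded card])
    fix t i assume "t \<in> S - {t0}" "i \<le> (n + 1) div 2" "real i * \<delta> \<le> \<bar>t\<bar>"
    then show "\<kappa> * real i \<le> f t"
      using Suc.prems(4)[of t i] unfolding Suc.hyps(2)[symmetric] by auto
  qed (use Suc.prems in auto)
  have "\<kappa> ^ card S * (\<Prod>j<card S. real (j div 2 + 1))
      = (\<kappa> * real (n div 2 + 1)) * (\<kappa> ^ n * (\<Prod>j<n. real (j div 2 + 1)))"
    unfolding Suc.hyps(2)[symmetric] by (simp add: mult_ac)
  also have "\<dots> \<le> f t0 * (\<Prod>t\<in>S - {t0}. f t)"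
    using f0 IH assms(3) by (intro mult_mono) (auto intro!: mult_nonneg_nonneg prod_nonneg order_trans[OF _ f0])
  also have "\<dots> = (\<Prod>t\<in>S. f t)"
    using t0(1) Suc.prems(1) by (simp add: prod.remove[symmetric])
  finally show ?case .
qed

text \<open>If \<open>k\<close> is \<open>q\<close>, concavity with factor 2 i q / n passes from the
  angle pi n \<open>\<delta>\<close> / 2 to pi q i \<open>\<delta>\<close>, and monotonicity goes on
  to pi q a. Otherwise k a lies between 1/4 and 1/2, so the right side is at least 1/2 while the
  left side is at most 1/2.\<close>

lemma capped_sine_ge:
  fixes q i :: nat and n a \<delta> :: real
  assumes "q \<ge> 1" and a: "0 < a" "a \<le> 1 / 2" and i: "i * \<delta> \<le> a" "2 * i * q \<le> n" and n: "n > 0"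
    and \<delta>: "\<delta> > 0" "n * \<delta> \<le> 1"
  defines "k \<equiv> min q (nat \<lfloor>1 / (2 * a)\<rfloor>)"
  shows "q / n * sin (pi / 2 * n * \<delta>) * i \<le> sin (pi * k * a)"
proof -
  have nd: "0 \<le> n * \<delta>" using n \<delta> by simp
  then have sb: "0 \<le> sin (pi / 2 * n * \<delta>)" "sin (pi / 2 * n * \<delta>) \<le> 1"
    using \<delta> by (auto simp: mult.assoc intro!: sin_ge_zero mult_left_le order_trans[of "pi/2 * (n * \<delta>)" "pi/2" pi])
  show ?thesis
  proof (cases "q \<le> nat \<lfloor>1 / (2 * a)\<rfloor>")
    case True
    then have k: "k = q" by (simp add: k_def)
    have "int q \<le> \<lfloor>1 / (2 * a)\<rfloor>" using True assms(1) by linarith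
    then have "real q \<le> 1 / (2 * a)" by (simp add: le_floor_iff)
    then have qa: "real q * a \<le> 1 / 2" using a by (simp add: field_simps)
    define c where "c = 2 * i * q / n"
    have c: "0 \<le> c" "c \<le> 1" using i n by (auto simp: c_def)
    have "q / n * sin (pi / 2 * n * \<delta>) * i \<le> c * sin (pi / 2 * n * \<delta>)"
      using sb n by (simp add: c_def field_simps)
    also have "\<dots> \<le> sin (c * (pi / 2 * n * \<delta>))"
      using c nd \<delta> by (intro sin_scaled_ge) (auto simp: mult.assoc intro!: order_trans[of "pi/2 * (n * \<delta>)" "pi/2" pi] mult_left_le)
    also have "c * (pi / 2 * n * \<delta>) = pi * q * (i * \<delta>)"
      using n by (simp add: c_def)
    also have "sin (pi * q * (i * \<delta>)) \<le> sin (pi * q * a)"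
    proof (rule sin_monotone_2pi_le)
      have "0 \<le> pi * q * (i * \<delta>)" using \<delta> by simp
      then show "- (pi / 2) \<le> pi * q * (i * \<delta>)" using pi_gt_zero by linarith
      show "pi * q * (i * \<delta>) \<le> pi * q * a" using i(1) by (intro mult_left_mono) auto
      show "pi * q * a \<le> pi / 2" using mult_left_mono[OF qa, of pi] by (simp add: mult.assoc)
    qed
    finally show ?thesis unfolding k .
  next
    case False
    define x where "x = 1 / (2 * a)"
    have x: "x \<ge> 1" using a by (simp add: x_def field_simps)
    have k: "k = nat \<lfloor>x\<rfloor>" using False by (simp add: k_def x_def)
    have fl: "real_of_int \<lfloor>x\<rfloor> \<le> x" "x < real_of_int \<lfloor>x\<rfloor> + 1" "1 \<le> \<lfloor>x\<rfloor>"
      using x by (auto simp: le_floor_iff)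
    have "real k = real_of_int \<lfloor>x\<rfloor>" unfolding k using fl(3) by simp
    moreover have "(1::real) \<le> real_of_int \<lfloor>x\<rfloor>" using fl(3) by (simp only: of_int_1_le_iff)
    ultimately have "real k \<le> x" "x \<le> 2 * real k" using fl by linarith+
    then have ka: "real k * a \<le> 1 / 2" "1 / 2 \<le> 2 * (real k * a)"
      using a unfolding x_def by (auto simp: field_simps)
    have "real i * real q / n \<le> 1 / 2" using i(2) n by (simp add: field_simps)
    then have "q / n * sin (pi / 2 * n * \<delta>) * i \<le> 1 / 2 * 1"
      using mult_mono[of "real i * real q / n" "1/2" "sin (pi / 2 * n * \<delta>)" 1] sb n by (simp add: mult_ac)
    also have "\<dots> \<le> sin (pi * k * a)"
      using sin_pi_times_ge[of "real k * a"] ka by (simp add: mult.assoc)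
    finally show ?thesis .
  qed
qed


section \<open>Estimates for the product attached to a node\<close>

lemma nat_floor_bounds:
  assumes "(1::real) \<le> x"
  shows "1 \<le> nat \<lfloor>x\<rfloor>" "real (nat \<lfloor>x\<rfloor>) = of_int \<lfloor>x\<rfloor>" "real (nat \<lfloor>x\<rfloor>) \<le> x"
    "x - 1 < real (nat \<lfloor>x\<rfloor>)" "x \<le> 2 * real (nat \<lfloor>x\<rfloor>)"
proof -
  have 1: "1 \<le> \<lfloor>x\<rfloor>" using assms by (simp add: one_le_floor)
  then show "1 \<le> nat \<lfloor>x\<rfloor>" by linarith
  show 2: "real (nat \<lfloor>x\<rfloor>) = of_int \<lfloor>x\<rfloor>" using 1 by simp
  have 3: "(1::real) \<le> of_int \<lfloor>x\<rfloor>" using 1 by (simp only: of_int_1_le_iff)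
  show "real (nat \<lfloor>x\<rfloor>) \<le> x" "x - 1 < real (nat \<lfloor>x\<rfloor>)" "x \<le> 2 * real (nat \<lfloor>x\<rfloor>)"
    unfolding 2 using 3 by linarith+
qed

lemma sin_capped_pos:
  assumes "q \<ge> 1" "0 < a" "a \<le> 1 / 2"
  shows "0 < sin (pi * min q (nat \<lfloor>1 / (2 * a)\<rfloor>) * a)"
proof -
  have "1 \<le> 1 / (2 * a)" using assms by simp
  note fl = nat_floor_bounds[OF this]
  have "real (min q (nat \<lfloor>1 / (2 * a)\<rfloor>)) \<le> real (nat \<lfloor>1 / (2 * a)\<rfloor>)" by (simp only: of_nat_le_iff min.cobounded2)
  then have "real (min q (nat \<lfloor>1 / (2 * a)\<rfloor>)) * a \<le> 1 / (2 * a) * a"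
    using order_trans[OF _ fl(3)] assms(2) by (simp add: mult_right_mono del: times_divide_eq_left)
  then have "real (min q (nat \<lfloor>1 / (2 * a)\<rfloor>)) * a \<le> 1 / 2" using assms by simp
  moreover have "0 < real (min q (nat \<lfloor>1 / (2 * a)\<rfloor>)) * a" using assms fl(1) by simp
  ultimately show ?thesis
    using sin_pi_times_ge[of "real (min q (nat \<lfloor>1 / (2 * a)\<rfloor>)) * a"] by (simp add: mult.assoc)
qed

lemma inverse_sin_squared_le:
  assumes "k * a \<le> 1 / 2" "0 < c" "c \<le> k" "0 < a"
  shows "1 / (sin (pi * k * a))\<^sup>2 \<le> (1 / (2 * c * a))\<^sup>2"
proof -
  have "2 * c * a \<le> 2 * (k * a)" using assms by simp
  also have "\<dots> \<le> sin (pi * (k * a))" using assms by (intro sin_pi_times_ge) auto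
  finally have "2 * c * a \<le> sin (pi * k * a)" by (simp add: mult.assoc)
  moreover have "0 < 2 * c * a" using assms by simp
  ultimately have "(2 * c * a)\<^sup>2 \<le> (sin (pi * k * a))\<^sup>2" "0 < (2 * c * a)\<^sup>2" by (auto intro: power_mono)
  then show ?thesis unfolding power_divide by (simp add: frac_le)
qed

text \<open>The threshold \<open>\<alpha>\<close> is where 1 / (2 a) equals \<open>t\<close>, so it
  decides which entry of the minimum is \<open>k\<close>. Above it, 1 / (2 k a) is the value of
  \<open>phi\<close>; below it, \<open>k\<close> exceeds t - 1 and 2 (t - 1) = (1 - 2
  \<open>\<alpha>\<close>) / \<open>\<alpha>\<close>.\<close>

lemma inverse_sin_capped_le:
  assumes "2 \<le> t" "0 < a" "a \<le> 1 / 2" and \<alpha>: "\<alpha> = 1 / (2 * t)"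
  defines "k \<equiv> min (nat \<lfloor>t\<rfloor>) (nat \<lfloor>1 / (2 * a)\<rfloor>)"
  shows "\<alpha> < a \<Longrightarrow> 1 / (sin (pi * k * a))\<^sup>2 \<le> (phi (1 / (2 * a)))\<^sup>2"
    and "a \<le> \<alpha> \<Longrightarrow> 1 / (sin (pi * k * a))\<^sup>2 \<le> \<alpha>\<^sup>2 / ((1 - 2 * \<alpha>)\<^sup>2 * a\<^sup>2)"
proof -
  have y: "1 \<le> 1 / (2 * a)" using assms by simp
  note fl = nat_floor_bounds[OF y]
  have "real k \<le> real (nat \<lfloor>1 / (2 * a)\<rfloor>)" unfolding k_def by (simp only: of_nat_le_iff min.cobounded2)
  then have "real k * a \<le> 1 / (2 * a) * a"
    using order_trans[OF _ fl(3)] assms(2) by (simp add: mult_right_mono del: times_divide_eq_left)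
  then have ka: "real k * a \<le> 1 / 2" using assms by simp
  have t: "1 \<le> t" using assms by simp
  {
    assume "\<alpha> < a"
    then have "1 / (2 * a) \<le> t" using assms by (simp add: field_simps)
    then have "k = nat \<lfloor>1 / (2 * a)\<rfloor>" unfolding k_def by (simp add: floor_mono min_absorb2 nat_mono)
    then have rk: "real k = of_int \<lfloor>1 / (2 * a)\<rfloor>" "0 < real k" using fl(1,2) y by auto
    show "1 / (sin (pi * k * a))\<^sup>2 \<le> (phi (1 / (2 * a)))\<^sup>2"
      using inverse_sin_squared_le[OF ka rk(2) order_refl assms(2)]
      unfolding phi_def rk(1)[symmetric] by (simp add: mult_ac)
  }
  {
    assume "a \<le> \<alpha>"
    then have "t \<le> 1 / (2 * a)" using assms by (simp add: field_simps)
    then have "k = nat \<lfloor>t\<rfloor>" unfolding k_def by (simp add: floor_mono min_absorb1 nat_mono)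
    then have "t - 1 \<le> real k" using nat_floor_bounds(4)[OF t] by simp
    then have "1 / (sin (pi * k * a))\<^sup>2 \<le> (1 / (2 * (t - 1) * a))\<^sup>2"
      using inverse_sin_squared_le[OF ka, of "t - 1"] assms by simp
    also have "1 / (2 * (t - 1) * a) = \<alpha> / ((1 - 2 * \<alpha>) * a)"
      unfolding \<alpha> using assms by (simp add: field_simps)
    finally show "1 / (sin (pi * k * a))\<^sup>2 \<le> \<alpha>\<^sup>2 / ((1 - 2 * \<alpha>)\<^sup>2 * a\<^sup>2)"
      by (simp add: power_divide power_mult_distrib)
  }
qed

lemma node_product_le_first:
  fixes d :: "'a \<Rightarrow> real"
  assumes "finite Y" and t: "2 \<le> t" and d: "\<And>y. y \<in> Y \<Longrightarrow> 0 < d y \<and> d y \<le> 1 / 2" and \<alpha>: "\<alpha> = 1 / (2 * t)"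
  shows "1 / real (nat \<lfloor>t\<rfloor>) * (\<Prod>y\<in>Y. 1 / (sin (pi * min (nat \<lfloor>t\<rfloor>) (nat \<lfloor>1 / (2 * d y)\<rfloor>) * d y))\<^sup>2)
    \<le> 2 * \<alpha> / (1 - 2 * \<alpha>) * (\<Prod>y\<in>{y\<in>Y. \<alpha> < d y}. (phi (1 / (2 * d y)))\<^sup>2) *
      (\<Prod>y\<in>{y\<in>Y. d y \<le> \<alpha>}. \<alpha>\<^sup>2 / ((1 - 2 * \<alpha>)\<^sup>2 * (d y)\<^sup>2))"
proof -
  let ?f = "\<lambda>y. 1 / (sin (pi * min (nat \<lfloor>t\<rfloor>) (nat \<lfloor>1 / (2 * d y)\<rfloor>) * d y))\<^sup>2"
  have "prod ?f Y = prod ?f ({y\<in>Y. \<alpha> < d y} \<union> {y\<in>Y. d y \<le> \<alpha>})"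
    by (rule arg_cong[of _ _ "prod ?f"]) auto
  also have "\<dots> = prod ?f {y\<in>Y. \<alpha> < d y} * prod ?f {y\<in>Y. d y \<le> \<alpha>}"
    using \<open>finite Y\<close> by (intro prod.union_disjoint) auto
  also have "\<dots> \<le> (\<Prod>y\<in>{y\<in>Y. \<alpha> < d y}. (phi (1 / (2 * d y)))\<^sup>2) *
      (\<Prod>y\<in>{y\<in>Y. d y \<le> \<alpha>}. \<alpha>\<^sup>2 / ((1 - 2 * \<alpha>)\<^sup>2 * (d y)\<^sup>2))"
    using inverse_sin_capped_le[OF t _ _ \<alpha>] d by (intro mult_mono prod_mono prod_nonneg) auto
  finally have 1: "prod ?f Y \<le> \<dots>" .
  have "1 / real (nat \<lfloor>t\<rfloor>) \<le> 1 / (t - 1)"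
    using nat_floor_bounds(4)[of t] t by (intro divide_left_mono mult_pos_pos) auto
  also have "\<dots> = 2 * \<alpha> / (1 - 2 * \<alpha>)" unfolding \<alpha> using t by (simp add: field_simps)
  finally have 2: "1 / real (nat \<lfloor>t\<rfloor>) \<le> 2 * \<alpha> / (1 - 2 * \<alpha>)" .
  have "1 / real (nat \<lfloor>t\<rfloor>) * prod ?f Y \<le> 2 * \<alpha> / (1 - 2 * \<alpha>) * ((\<Prod>y\<in>{y\<in>Y. \<alpha> < d y}. (phi (1 / (2 * d y)))\<^sup>2) *
      (\<Prod>y\<in>{y\<in>Y. d y \<le> \<alpha>}. \<alpha>\<^sup>2 / ((1 - 2 * \<alpha>)\<^sup>2 * (d y)\<^sup>2)))"
    using 1 2 by (intro mult_mono prod_nonneg) (auto intro: order_trans[OF _ 2])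
  then show ?thesis by (simp add: mult.assoc)
qed

lemma phi_bounds:
  assumes "1 \<le> x"
  shows "0 \<le> phi x" "phi x \<le> 2"
  using nat_floor_bounds[OF assms] assms unfolding phi_def by (auto simp: divide_le_eq)

text \<open>Cruder form: \<open>\<alpha>\<close> <= 1/4 gives 1 - 2 \<open>\<alpha>\<close> >= 1/2,
  and \<open>phi\<close> is at most 2 because a number above 1 is at most twice its floor.\<close>

lemma first_le_second:
  fixes d :: "'a \<Rightarrow> real"
  assumes "finite J" "finite I" and \<alpha>: "0 < \<alpha>" "\<alpha> \<le> 1 / 4"
    and J: "\<And>y. y \<in> J \<Longrightarrow> 0 < d y \<and> d y \<le> 1 / 2" and I: "\<And>y. y \<in> I \<Longrightarrow> 0 < d y"
  shows "2 ^ \<nu> * (2 * \<alpha> / (1 - 2 * \<alpha>)) * (\<Prod>y\<in>J. (phi (1 / (2 * d y)))\<^sup>2) *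
      (\<Prod>y\<in>I. \<alpha>\<^sup>2 / ((1 - 2 * \<alpha>)\<^sup>2 * (d y)\<^sup>2))
    \<le> 4 * \<alpha> * 2 ^ \<nu> * (2 ^ card J)\<^sup>2 / (\<Prod>y\<in>I. d y / (2 * \<alpha>))\<^sup>2"
proof -
  have 1: "2 * \<alpha> / (1 - 2 * \<alpha>) \<le> 4 * \<alpha>"
  proof -
    have "2 * \<alpha> \<le> 4 * \<alpha> * (1 - 2 * \<alpha>)" using mult_left_mono[OF \<alpha>(2), of "8 * \<alpha>"] \<alpha> by (simp add: algebra_simps)
    then show ?thesis using \<alpha> by (simp add: pos_divide_le_eq)
  qed
  have 2: "(\<Prod>y\<in>J. (phi (1 / (2 * d y)))\<^sup>2) \<le> (\<Prod>y\<in>J. 2\<^sup>2)"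
  proof (rule prod_mono)
    fix y assume "y \<in> J"
    then have "1 \<le> 1 / (2 * d y)" using J[of y] by simp
    from power_mono[OF phi_bounds(2,1)[OF this], of 2]
    show "0 \<le> (phi (1 / (2 * d y)))\<^sup>2 \<and> (phi (1 / (2 * d y)))\<^sup>2 \<le> 2\<^sup>2" by simp
  qed
  have 3: "(\<Prod>y\<in>I. \<alpha>\<^sup>2 / ((1 - 2 * \<alpha>)\<^sup>2 * (d y)\<^sup>2)) \<le> (\<Prod>y\<in>I. 1 / (d y / (2 * \<alpha>))\<^sup>2)"
  proof (rule prod_mono)
    fix y assume "y \<in> I"
    then have y: "0 < d y" using I by simp
    have "\<alpha> / ((1 - 2 * \<alpha>) * d y) \<le> \<alpha> / (1 / 2 * d y)"
      using \<alpha> y by (intro divide_left_mono mult_right_mono mult_pos_pos) auto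
    also have "\<dots> = 1 / (d y / (2 * \<alpha>))" by simp
    finally have "(\<alpha> / ((1 - 2 * \<alpha>) * d y))\<^sup>2 \<le> (1 / (d y / (2 * \<alpha>)))\<^sup>2"
      using \<alpha> y by (intro power_mono) auto
    then show "0 \<le> \<alpha>\<^sup>2 / ((1 - 2 * \<alpha>)\<^sup>2 * (d y)\<^sup>2) \<and> \<alpha>\<^sup>2 / ((1 - 2 * \<alpha>)\<^sup>2 * (d y)\<^sup>2) \<le> 1 / (d y / (2 * \<alpha>))\<^sup>2"
      by (simp add: power_divide power_mult_distrib)
  qed
  have "2 ^ \<nu> * (2 * \<alpha> / (1 - 2 * \<alpha>)) * (\<Prod>y\<in>J. (phi (1 / (2 * d y)))\<^sup>2) * (\<Prod>y\<in>I. \<alpha>\<^sup>2 / ((1 - 2 * \<alpha>)\<^sup>2 * (d y)\<^sup>2))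
    \<le> 2 ^ \<nu> * (4 * \<alpha>) * (\<Prod>y\<in>J. 2\<^sup>2) * (\<Prod>y\<in>I. 1 / (d y / (2 * \<alpha>))\<^sup>2)"
    using 1 2 3 \<alpha> by (intro mult_mono) (auto intro!: prod_nonneg mult_nonneg_nonneg)
  also have "\<dots> = 4 * \<alpha> * 2 ^ \<nu> * (2 ^ card J)\<^sup>2 / (\<Prod>y\<in>I. d y / (2 * \<alpha>))\<^sup>2"
  proof -
    have "(\<Prod>y\<in>J. 2\<^sup>2 :: real) = (2 ^ card J)\<^sup>2" by (simp only: prod_constant power_mult[symmetric] mult.commute)
    moreover have "(\<Prod>y\<in>I. 1 / (d y / (2 * \<alpha>))\<^sup>2) = 1 / (\<Prod>y\<in>I. d y / (2 * \<alpha>))\<^sup>2"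
      using prod_dividef[of "\<lambda>_. 1" "\<lambda>y. (d y / (2 * \<alpha>))\<^sup>2" I] prod_power_distrib[of "\<lambda>y. d y / (2 * \<alpha>)" I 2]
      by (simp only: prod.neutral_const)
    ultimately show ?thesis by simp
  qed
  finally show ?thesis .
qed

text \<open>The lifts \<open>T\<close> place the near nodes on the line around the base node.
  Ordering them by distance bounds the product of capped sines, and \<open>prod_half_ge\<close>
  evaluates the resulting integer product.\<close>

lemma node_product_le_third:
  fixes T :: "'a \<Rightarrow> real" and n :: int and r :: nat and N t \<delta> :: real
  assumes "finite Y" and r: "r = card Y + 1" and t: "t = N / r" "2 \<le> t" and n: "n = \<lfloor>N\<rfloor>"
    and T: "\<And>y. y \<in> Y \<Longrightarrow> \<delta> \<le> \<bar>T y\<bar> \<and> \<bar>T y\<bar> = d y \<and> d y \<le> 1 / 2"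
    and sep: "\<And>y y'. \<lbrakk>y \<in> Y; y' \<in> Y; y \<noteq> y'\<rbrakk> \<Longrightarrow> \<delta> \<le> \<bar>T y - T y'\<bar>"
    and \<delta>: "0 < \<delta>" "N * \<delta> \<le> 1"
  shows "1 / real (nat \<lfloor>t\<rfloor>) * (\<Prod>y\<in>Y. 1 / (sin (pi * min (nat \<lfloor>t\<rfloor>) (nat \<lfloor>1 / (2 * d y)\<rfloor>) * d y))\<^sup>2)
    \<le> 4 * (exp 1)\<^sup>2 / pi\<^sup>2 * (phi (n / r) / (r * n)) * (2 * exp 1 * phi (n / r) / sin (pi / 2 * n * \<delta>)) ^ (2 * r - 2)"
proof -
  define q where "q = nat \<lfloor>t\<rfloor>"
  have r0: "real r \<ge> 1" using r by simp
  have N: "N = t * r" using t r0 by simp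
  have N2: "N \<ge> 2" unfolding N using mult_mono[OF t(2) r0] t(2) by simp
  have nN: "of_int n \<le> N" by (simp add: n)
  have n1: "real_of_int n > 0" using N2 unfolding n by (simp add: less_floor_iff)
  \<comment> \<open>For a positive integer divisor, the floor of the quotient does not change when
    the numerator is rounded down first.\<close>
  have fl: "\<lfloor>t\<rfloor> = \<lfloor>of_int n / real r\<rfloor>"
    unfolding t(1) n
    using floor_divide_real_eq_div[of "int r" N] floor_divide_of_int_eq[of "\<lfloor>N\<rfloor>" "int r", where ?'a = real] by simp
  have q: "q \<ge> 1" "real q = of_int \<lfloor>of_int n / real r\<rfloor>"
    using nat_floor_bounds[of t] t unfolding q_def fl by auto
  have "real q \<le> n / r" unfolding q(2) by simp
  then have qr: "real q * r \<le> n" using r0 by (simp add: pos_le_divide_eq)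
  have phi: "phi (n / r) = n / (r * q)" unfolding phi_def q(2)[symmetric] by simp
  define S where "S = sin (pi / 2 * n * \<delta>)"
  have "n * \<delta> \<le> N * \<delta>" using nN \<delta>(1) by (simp add: mult_right_mono)
  from n1 \<delta>(1) order_trans[OF this \<delta>(2)] have nd: "0 < n * \<delta>" "n * \<delta> \<le> 1" by simp_all
  have "0 < pi / 2 * (n * \<delta>)" "pi / 2 * (n * \<delta>) < pi"
    using nd pi_gt_zero mult_left_mono[OF nd(2), of "pi / 2"] by (auto intro: le_less_trans)
  then have S: "S > 0" unfolding S_def by (intro sin_gt_zero) (auto simp: mult.assoc)
  define \<kappa> where "\<kappa> = q / n * S"
  have \<kappa>: "\<kappa> > 0" unfolding \<kappa>_def using q(1) n1 S by (intro mult_pos_pos divide_pos_pos) simp_all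
  define f where "f = (\<lambda>a. sin (pi * min q (nat \<lfloor>1 / (2 * \<bar>a\<bar>)\<rfloor>) * \<bar>a\<bar>))"
  have inj: "inj_on T Y" using sep \<delta> by (force intro!: inj_onI)
  have cardT: "card (T ` Y) = r - 1" using card_image[OF inj] r by simp
  have "\<kappa> ^ card (T ` Y) * (\<Prod>j<card (T ` Y). real (j div 2 + 1)) \<le> (\<Prod>a\<in>T ` Y. f a)"
  proof (rule prod_separated_ge)
    fix a and i :: nat assume a: "a \<in> T ` Y" "i \<le> (card (T ` Y) + 1) div 2" "i * \<delta> \<le> \<bar>a\<bar>"
    \<comment> \<open>This gives 2 i q <= r q <= n, the condition of the capped sine
      estimate.\<close>
    have "2 * i \<le> r" using a(2) r cardT by simp
    then have "real (2 * i) \<le> real r" by (simp only: of_nat_le_iff)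
    then have "real (2 * i) * real q \<le> real r * real q" by (rule mult_right_mono) simp
    then have "2 * real i * real q \<le> n" using qr by (simp add: mult.commute)
    then show "\<kappa> * i \<le> f a"
      unfolding \<kappa>_def f_def S_def
      using a T \<delta> nd n1 q(1) by (intro capped_sine_ge) force+
  next
    show "\<delta> \<le> \<bar>a\<bar>" if "a \<in> T ` Y" for a using that T by auto
    show "\<delta> \<le> \<bar>a - b\<bar>" if "a \<in> T ` Y" "b \<in> T ` Y" "a \<noteq> b" for a b using that sep by auto
  qed (use assms \<kappa> in auto)
  then have "\<kappa> ^ (r - 1) * (\<Prod>j<r - 1. real (j div 2 + 1)) \<le> (\<Prod>y\<in>Y. f (T y))"
    unfolding cardT prod.reindex[OF inj] by simp
  moreover have "pi * (r / (2 * exp 1)) ^ r \<le> (\<Prod>j<r - 1. real (j div 2 + 1))"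
    using prod_half_ge[of "r - 1"] r by simp
  ultimately have main: "\<kappa> ^ (r - 1) * (pi * (r / (2 * exp 1)) ^ r) \<le> (\<Prod>y\<in>Y. f (T y))"
    using \<kappa> by (meson mult_left_mono order_trans zero_le_power less_imp_le)
  define L where "L = \<kappa> ^ (r - 1) * (pi * (r / (2 * exp 1)) ^ r)"
  have L: "L > 0" using \<kappa> r0 by (simp add: L_def)
  have "(\<Prod>y\<in>Y. 1 / (sin (pi * min q (nat \<lfloor>1 / (2 * d y)\<rfloor>) * d y))\<^sup>2) = 1 / (\<Prod>y\<in>Y. f (T y))\<^sup>2"
    unfolding prod_power_distrib f_def prod_dividef using T by (simp cong: prod.cong)
  also have "\<dots> \<le> 1 / L\<^sup>2"
    using main L unfolding L_def[symmetric] by (intro divide_left_mono power_mono mult_pos_pos) (auto intro!: zero_less_power)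
  finally have "1 / real q * (\<Prod>y\<in>Y. 1 / (sin (pi * min q (nat \<lfloor>1 / (2 * d y)\<rfloor>) * d y))\<^sup>2) \<le> 1 / real q * (1 / L\<^sup>2)"
    by (intro mult_left_mono) auto
  \<comment> \<open>Algebra with R = r / (2 e): \<open>L\<close> consists of r - 1 factors
    \<open>\<kappa> * R\<close> and one factor pi R, which carries the constant in front.\<close>
  also have "1 / real q * (1 / L\<^sup>2) = 4 * (exp 1)\<^sup>2 / pi\<^sup>2 * (phi (n / r) / (r * n)) * (2 * exp 1 * phi (n / r) / S) ^ (2 * r - 2)"
  proof -
    define e :: real where "e = exp 1"
    have e: "e > 0" by (simp add: e_def)
    define R where "R = real r / (2 * e)"
    have R: "R > 0" using r0 e by (simp add: R_def)
    have "2 * e * phi (n / r) / S = 1 / (\<kappa> * R)"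
      unfolding phi \<kappa>_def R_def using n1 q(1) r0 S e by (simp add: field_simps)
    moreover have "4 * e\<^sup>2 / pi\<^sup>2 * (phi (n / r) / (r * n)) = 1 / (real q * (pi * R)\<^sup>2)"
      unfolding phi R_def using n1 q(1) r0 e by (simp add: field_simps power2_eq_square)
    moreover have "L = (\<kappa> * R) ^ (r - 1) * (pi * R)"
      unfolding L_def R_def[symmetric, unfolded e_def] using r by (simp add: power_mult_distrib)
    moreover have "2 * r - 2 = (r - 1) * 2" by simp
    moreover have "1 / real q * (1 / (x ^ k * y)\<^sup>2) = 1 / (real q * y\<^sup>2) * (1 / x) ^ (k * 2)" for x y k
      by (simp add: power_divide power_mult power_mult_distrib)
    ultimately show ?thesis unfolding e_def[symmetric] by simp
  qed
  finally show ?thesis unfolding q_def S_def .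
qed

text \<open>Jordan's inequality bounds the sine below by n \<open>\<delta>\<close>, and this
  \<open>n\<close> cancels against the numerator of \<open>phi\<close>. The 6 combines q >= t / 2
  with N >= m / 3.\<close>

lemma third_le_fourth:
  fixes n :: int and r :: nat and N t m \<delta> :: real
  assumes r: "r \<ge> 1" and t: "t = N / r" "2 \<le> t" and n: "n = \<lfloor>N\<rfloor>" and m: "0 < m" "m \<le> 3 * N"
    and \<delta>: "0 < \<delta>" "N * \<delta> \<le> 1"
  shows "4 * (exp 1)\<^sup>2 / pi\<^sup>2 * (phi (n / r) / (r * n)) * (2 * exp 1 * phi (n / r) / sin (pi / 2 * n * \<delta>)) ^ (2 * r - 2)
    \<le> 4 * (exp 1)\<^sup>2 / pi\<^sup>2 * (6 / (m * r)) * (12 * exp 1 / (m * \<delta>)) ^ (2 * r - 2)"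
proof -
  define q where "q = nat \<lfloor>t\<rfloor>"
  have r0: "real r \<ge> 1" using r by simp
  have N: "N = t * r" using t r0 by simp
  have N2: "N \<ge> 2" unfolding N using mult_mono[OF t(2) r0] t(2) by simp
  have nN: "of_int n \<le> N" by (simp add: n)
  have n1: "real_of_int n > 0" using N2 unfolding n by (simp add: less_floor_iff)
  have fl: "\<lfloor>t\<rfloor> = \<lfloor>of_int n / real r\<rfloor>"
    unfolding t(1) n
    using floor_divide_real_eq_div[of "int r" N] floor_divide_of_int_eq[of "\<lfloor>N\<rfloor>" "int r", where ?'a = real] by simp
  have q: "q \<ge> 1" "real q = of_int \<lfloor>of_int n / real r\<rfloor>" "t \<le> 2 * real q"
    using nat_floor_bounds[of t] t unfolding q_def fl by auto
  have phi: "phi (n / r) = n / (r * q)" unfolding phi_def q(2)[symmetric] by simp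
  have "N \<le> 2 * (r * q)" using mult_right_mono[OF q(3), of "real r"] N by (simp add: mult_ac)
  then have rq: "m / 6 \<le> real r * real q" using m by simp
  have "n * \<delta> \<le> N * \<delta>" using nN \<delta>(1) by (simp add: mult_right_mono)
  from n1 \<delta>(1) order_trans[OF this \<delta>(2)] have nd: "0 < n * \<delta>" "n * \<delta> \<le> 1" by simp_all
  have "n * \<delta> \<le> sin (pi * (n * \<delta> / 2))" using sin_pi_times_ge[of "n * \<delta> / 2"] nd by simp
  then have S: "n * \<delta> \<le> sin (pi / 2 * n * \<delta>)" by (simp add: mult_ac)
  have Sp: "0 < sin (pi / 2 * n * \<delta>)" using S nd by linarith
  have c: "0 \<le> 2 * exp 1 * phi (n / r)" unfolding phi using n1 by simp
  have rq0: "0 < real r * real q" using r0 q(1) by simp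
  have "2 * exp 1 * phi (n / r) / sin (pi / 2 * n * \<delta>) \<le> 2 * exp 1 * phi (n / r) / (n * \<delta>)"
    by (rule divide_left_mono[OF S c]) (use Sp nd in simp)
  also have "\<dots> = 2 * exp 1 / (real r * real q * \<delta>)" unfolding phi using n1 by simp
  also have "\<dots> \<le> 2 * exp 1 / (m / 6 * \<delta>)"
    by (rule divide_left_mono, rule mult_right_mono[OF rq]) (use rq0 m \<delta> in simp_all)
  finally have 1: "2 * exp 1 * phi (n / r) / sin (pi / 2 * n * \<delta>) \<le> 12 * exp 1 / (m * \<delta>)" by simp
  have "phi (n / r) / (r * n) = 1 / (real r * real q * r)" unfolding phi using n1 by simp
  also have "\<dots> \<le> 1 / (m / 6 * r)"
    by (rule divide_left_mono, rule mult_right_mono[OF rq]) (use rq0 m r0 in simp_all)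
  finally have 2: "phi (n / r) / (r * n) \<le> 6 / (m * r)" by simp
  have "0 \<le> 2 * exp 1 * phi (n / r) / sin (pi / 2 * n * \<delta>)" using c Sp by simp
  from power_mono[OF 1 this, of "2 * r - 2"]
  have 3: "(2 * exp 1 * phi (n / r) / sin (pi / 2 * n * \<delta>)) ^ (2 * r - 2) \<le> (12 * exp 1 / (m * \<delta>)) ^ (2 * r - 2)" .
  have 4: "4 * (exp 1)\<^sup>2 / pi\<^sup>2 * (phi (n / r) / (r * n)) \<le> 4 * (exp 1)\<^sup>2 / pi\<^sup>2 * (6 / (m * r))"
    using 2 by (rule mult_left_mono) simp
  show ?thesis
    by (rule mult_mono[OF 4 3]) (use m c Sp in simp_all)
qed

text \<open>Every term is at most the one formed with the minimum; the \<open>s\<close> in the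
  denominators cancels the number of terms.\<close>

lemma min_le_of_inverse_square_bound:
  fixes b :: "nat \<Rightarrow> real"
  assumes s: "s \<ge> 1" and \<sigma>: "\<sigma> > 0" "1 / \<sigma>\<^sup>2 \<le> (\<Sum>k=1..s. E k)"
    and b: "\<And>k. k \<in> {1..s} \<Longrightarrow> 0 < b k \<and> E k \<le> 1 / (real s * (b k)\<^sup>2)"
  shows "(MIN k\<in>{1..s}. b k) \<le> \<sigma>"
proof -
  define B where "B = (MIN k\<in>{1..s}. b k)"
  have "B \<in> b ` {1..s}" unfolding B_def using s by (intro Min_in) auto
  then have B: "B > 0" using b by auto
  have "E k \<le> 1 / (real s * B\<^sup>2)" if "k \<in> {1..s}" for k
  proof -
    have "B \<le> b k" unfolding B_def using that by simp
    then have "1 / (real s * (b k)\<^sup>2) \<le> 1 / (real s * B\<^sup>2)"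
      using B s b[OF that] by (intro divide_left_mono mult_left_mono power_mono) auto
    then show ?thesis using b[OF that] by linarith
  qed
  then have "(\<Sum>k=1..s. E k) \<le> (\<Sum>k=1..s. 1 / (real s * B\<^sup>2))" by (intro sum_mono)
  also have "\<dots> = 1 / B\<^sup>2" using s by simp
  finally have "1 / \<sigma>\<^sup>2 \<le> 1 / B\<^sup>2" using \<sigma>(2) by simp
  then have "B\<^sup>2 \<le> \<sigma>\<^sup>2"
    using \<sigma>(1) by (intro inverse_le_imp_le[of "\<sigma>\<^sup>2"]) (simp_all add: inverse_eq_divide)
  then have "B \<le> \<sigma>" by (rule power2_le_imp_le) (use \<sigma>(1) in simp)
  then show ?thesis unfolding B_def .
qed


section \<open>Separated clumps\<close>

text \<open>A ball of radius \<open>\<tau>\<close> around a node stays inside its clump, as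
  different clumps are more than \<open>\<beta>\<close> apart; this is all the later proof takes
  from the clump structure.\<close>

lemma separated_clumps_near:
  fixes \<delta> \<tau> :: real and m lam :: nat
  assumes "s \<ge> 2" "m \<ge> 6 * s" and clumps: "separated_clumps X s \<delta> r lam \<alpha> \<beta>"
    and \<beta>: "r > 1 \<longrightarrow> \<beta> \<ge> 3 * lam / m" and \<tau>: "\<tau> = (if r = 1 then 1 / 2 else \<beta>)"
  shows "finite X" "card X = s" "\<And>u v. \<lbrakk>u \<in> X; v \<in> X; u \<noteq> v\<rbrakk> \<Longrightarrow> \<delta> \<le> \<bar>u - v\<bar>\<^sub>T"
    "0 < \<tau>" "\<tau> \<le> 1 / 2" "3 * lam / \<tau> \<le> m" "lam \<ge> 1"
    "\<And>u. u \<in> X \<Longrightarrow> card {v\<in>X. \<bar>u - v\<bar>\<^sub>T \<le> \<tau>} \<le> lam"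
proof -
  obtain C where fin: "finite X" "card X = s" "min_sep X \<ge> \<delta>" "r \<ge> 1"
    and C: "X = (\<Union>k\<in>{1..r}. C k)" "\<And>k. k \<in> {1..r} \<Longrightarrow> C k \<noteq> {}"
      "(MAX k\<in>{1..r}. card (C k)) = lam"
    and dist: "r \<ge> 2 \<Longrightarrow> Min {torus_setdist (C j) (C k) |j k. j \<in> {1..r} \<and> k \<in> {1..r} \<and> j \<noteq> k} > \<beta>"
    using clumps unfolding separated_clumps_def by blast
  show "finite X" "card X = s" by fact+
  have m: "real m > 0" "6 * real s \<le> m" using assms(1,2) by auto
  have finC: "finite (C k)" if "k \<in> {1..r}" for k
    using that fin(1) C(1) by (meson UN_upper finite_subset)
  have cardC: "card (C k) \<le> lam" if "k \<in> {1..r}" for k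
    unfolding C(3)[symmetric] using that by (intro Max_ge) auto
  have "card (C 1) \<noteq> 0" using finC[of 1] C(2)[of 1] fin(4) by auto
  then show lam: "lam \<ge> 1" using cardC[of 1] fin(4) by auto
  show "\<delta> \<le> \<bar>u - v\<bar>\<^sub>T" if "u \<in> X" "v \<in> X" "u \<noteq> v" for u v
  proof -
    have "{\<bar>x - y\<bar>\<^sub>T |x y. x \<in> X \<and> y \<in> X \<and> x \<noteq> y} \<subseteq> (\<lambda>(x, y). \<bar>x - y\<bar>\<^sub>T) ` (X \<times> X)" by auto
    then have "finite {\<bar>x - y\<bar>\<^sub>T |x y. x \<in> X \<and> y \<in> X \<and> x \<noteq> y}"
      by (rule finite_subset) (use fin(1) in simp)
    then have "min_sep X \<le> \<bar>u - v\<bar>\<^sub>T"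
      unfolding min_sep_def using that by (intro Min_le) auto
    then show ?thesis using fin(3) by simp
  qed
  have sep: "\<beta> < \<bar>u - v\<bar>\<^sub>T" if "j \<in> {1..r}" "k \<in> {1..r}" "j \<noteq> k" "u \<in> C j" "v \<in> C k" for j k u v
  proof -
    let ?D = "{torus_setdist (C j) (C k) |j k. j \<in> {1..r} \<and> k \<in> {1..r} \<and> j \<noteq> k}"
    have "?D \<subseteq> (\<lambda>(j, k). torus_setdist (C j) (C k)) ` ({1..r} \<times> {1..r})" by auto
    then have "finite ?D" by (rule finite_subset) simp
    then have "Min ?D \<le> torus_setdist (C j) (C k)" using that by (intro Min_le) auto
    moreover have "torus_setdist (C j) (C k) \<le> \<bar>u - v\<bar>\<^sub>T"
    proof -
      have "bdd_below ((\<lambda>(u, v). \<bar>u - v\<bar>\<^sub>T) ` (C j \<times> C k))"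
        by (rule bdd_belowI2[of _ 0]) auto
      then show ?thesis
        unfolding torus_setdist_def using cINF_lower[of "\<lambda>(u, v). \<bar>u - v\<bar>\<^sub>T" "C j \<times> C k" "(u, v)"] that by simp
    qed
    ultimately show ?thesis using dist that by fastforce
  qed
  have "0 < \<tau> \<and> \<tau> \<le> 1 / 2 \<and> 3 * lam / \<tau> \<le> m"
  \<comment> \<open>A single clump has \<open>lam = s\<close>, and 3 s / (1/2) <= m is the
    assumption on \<open>m\<close>. With more clumps, \<open>\<beta>\<close> lies below an actual
    torus distance, hence below 1/2.\<close>
  proof (cases "r = 1")
    case True
    then have "lam = s" using C(1,3) fin(2) by simp
    moreover have "\<tau> = 1 / 2" using True \<tau> by simp
    ultimately show ?thesis using m by (simp only:) simp
  next
    case False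
    then have r: "r \<ge> 2" using fin(4) by simp
    obtain u v where "u \<in> C 1" "v \<in> C 2" using C(2)[of 1] C(2)[of 2] r by auto
    then have "\<beta> < \<bar>u - v\<bar>\<^sub>T" using sep[of 1 2 u v] r by simp
    then have half: "\<beta> \<le> 1 / 2" using torus_norm_le_half[of "u - v"] by linarith
    have b: "\<beta> \<ge> 3 * lam / m" using \<beta> r by simp
    moreover have "3 * lam / m > 0" using lam m by simp
    ultimately have pos: "\<beta> > 0" by linarith
    have "3 * lam \<le> \<beta> * m" using b m by (simp add: pos_divide_le_eq)
    then have "3 * lam / \<beta> \<le> m" using pos by (simp add: pos_divide_le_eq mult.commute)
    then show ?thesis using half pos False \<tau> by simp
  qed
  then show "0 < \<tau>" "\<tau> \<le> 1 / 2" "3 * lam / \<tau> \<le> m" by simp_all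
  show "card {v\<in>X. \<bar>u - v\<bar>\<^sub>T \<le> \<tau>} \<le> lam" if u: "u \<in> X" for u
  proof -
    obtain j where j: "j \<in> {1..r}" "u \<in> C j" using u C(1) by auto
    have "{v\<in>X. \<bar>u - v\<bar>\<^sub>T \<le> \<tau>} \<subseteq> C j"
    proof
      fix v assume v: "v \<in> {v\<in>X. \<bar>u - v\<bar>\<^sub>T \<le> \<tau>}"
      then obtain k where k: "k \<in> {1..r}" "v \<in> C k" using C(1) by auto
      have "j = k"
      proof (rule ccontr)
        assume "j \<noteq> k"
        then have "\<tau> = \<beta>" using \<tau> j(1) k(1) by auto
        then show False using sep[OF j(1) k(1) \<open>j \<noteq> k\<close> j(2) k(2)] v by simp
      qed
      then show "v \<in> C j" using k by simp
    qed
    then have "card {v\<in>X. \<bar>u - v\<bar>\<^sub>T \<le> \<tau>} \<le> card (C j)" using finC[OF j(1)] by (rule card_mono[rotated])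
    then show ?thesis using cardC[OF j(1)] by simp
  qed
qed

lemma local_sparsity_le:
  assumes "finite X" "U \<subseteq> X" and "\<And>u. u \<in> X \<Longrightarrow> card {v\<in>X. \<bar>u - v\<bar>\<^sub>T \<le> \<tau>} \<le> l"
  shows "local_sparsity \<tau> U \<le> l"
proof (cases "U = {}")
  case False
  have "card {v\<in>U. \<bar>u - v\<bar>\<^sub>T \<le> \<tau>} \<le> l" if "u \<in> U" for u
  proof -
    have "card {v\<in>U. \<bar>u - v\<bar>\<^sub>T \<le> \<tau>} \<le> card {v\<in>X. \<bar>u - v\<bar>\<^sub>T \<le> \<tau>}"
      using assms by (intro card_mono) auto
    then show ?thesis using assms(3)[of u] that assms(2) by auto
  qed
  then show ?thesis
    unfolding local_sparsity_def using False finite_subset[OF assms(2,1)] by (simp add: Max_le_iff)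
qed (simp add: local_sparsity_def)

text \<open>Both exponents are raised to their largest value, as \<open>w\<close> is at most 1 and
  sqrt 2 at least 1; one of the \<open>l\<close> factors 1 / sqrt 2 is then split off.\<close>

lemma uniform_le_node_bound:
  fixes w :: real
  assumes "0 < w" "w \<le> 1" "1 \<le> r" "r \<le> l" "\<nu> \<le> l"
  shows "1 / sqrt 2 * (w / sqrt 2) ^ (l - 1) \<le> sqrt (real r / 2 ^ \<nu>) * w ^ (r - 1)"
proof -
  have l: "l = Suc (l - 1)" using assms by simp
  have "1 / sqrt 2 * (w / sqrt 2) ^ (l - 1) = w ^ (l - 1) / sqrt 2 ^ l"
    by (subst (3) l) (simp add: power_divide)
  also have "\<dots> \<le> w ^ (r - 1) / sqrt 2 ^ \<nu>"
    using assms by (intro frac_le power_decreasing power_increasing) auto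
  also have "\<dots> = sqrt (1 / 2 ^ \<nu>) * w ^ (r - 1)"
    by (simp add: real_sqrt_divide real_sqrt_power)
  also have "\<dots> \<le> sqrt (real r / 2 ^ \<nu>) * w ^ (r - 1)"
    using assms by (intro mult_right_mono real_sqrt_le_mono divide_right_mono) auto
  finally show ?thesis .
qed

theorem corollary1:
  fixes m s r lam :: nat and \<delta> \<alpha> \<beta> \<tau> :: real
    and X :: "torus set" and x :: "nat \<Rightarrow> torus"
    and G I J :: "nat \<Rightarrow> torus set" and rr \<nu> :: "nat \<Rightarrow> nat"
    and n :: "nat \<Rightarrow> int" and a :: "nat \<Rightarrow> real" and \<sigma> :: real
  assumes "s \<ge> 2" and "m \<ge> 6 * s"
    and "bij_betw x {1..s} X"
    and "separated_clumps X s \<delta> r lam \<alpha> \<beta>"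
    and "0 < \<delta>" and "\<delta> \<le> 1 / m"
    and "r > 1 \<Longrightarrow> \<beta> \<ge> 3 * lam / m"
    and "\<tau> = (if r = 1 then 1 / 2 else \<beta>)"
    and "\<sigma> = singular_value s (fourier_matrix m s x)"
    and "\<And>k. G k = far_set (x k) \<tau> X"
    and "\<And>k. \<nu> k = local_sparsity \<tau> (G k)"
    and "\<And>k. rr k = card (near_set (x k) \<tau> X)"
    and "\<And>k. n k = \<lfloor>m - 2 * \<nu> k / \<tau>\<rfloor>"
    and "\<And>k. a k = rr k / (2 * m - 4 * \<nu> k / \<tau>)"
    and "\<And>k. I k = {y\<in>X. 0 < \<bar>y - x k\<bar>\<^sub>T \<and> \<bar>y - x k\<bar>\<^sub>T \<le> a k}"
    and "\<And>k. J k = {y\<in>X. a k < \<bar>y - x k\<bar>\<^sub>T \<and> \<bar>y - x k\<bar>\<^sub>T \<le> \<tau>}"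
  shows "density_criterion m \<tau> X \<and>
    1 / \<sigma>\<^sup>2 \<le> (\<Sum>k=1..s. 2 ^ \<nu> k * (2 * a k / (1 - 2 * a k)) *
                 (\<Prod>y\<in>J k. (phi (1 / (2 * \<bar>y - x k\<bar>\<^sub>T)))\<^sup>2) *
                 (\<Prod>y\<in>I k. (a k)\<^sup>2 / ((1 - 2 * a k)\<^sup>2 * \<bar>y - x k\<bar>\<^sub>T\<^sup>2))) \<and>
    \<sigma> \<ge> (MIN k\<in>{1..s}. 1 / sqrt (4 * s * a k) * (1 / sqrt (2 ^ \<nu> k)) * (1 / 2 ^ card (J k)) *
                 (\<Prod>y\<in>I k. \<bar>y - x k\<bar>\<^sub>T / (2 * a k))) \<and>
    1 / \<sigma>\<^sup>2 \<le> 4 * (exp 1)\<^sup>2 / pi\<^sup>2 *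
              (\<Sum>k=1..s. 2 ^ \<nu> k * (phi (n k / rr k) / (rr k * n k)) *
                 (2 * exp 1 * phi (n k / rr k) / sin (pi / 2 * n k * \<delta>)) ^ (2 * rr k - 2)) \<and>
    \<sigma> \<ge> pi / (2 * exp 1) * sqrt (m / (6 * s)) *
              (MIN k\<in>{1..s}. sqrt (rr k / 2 ^ \<nu> k) * (m * \<delta> / (12 * exp 1)) ^ (rr k - 1)) \<and>
    \<sigma> \<ge> pi / (2 * exp 1) * sqrt (m / (12 * s)) * (m * \<delta> / (12 * sqrt 2 * exp 1)) ^ (lam - 1)"
proof -
  have "r > 1 \<longrightarrow> \<beta> \<ge> 3 * lam / m" using assms(7) by simp
  note clump = separated_clumps_near[OF assms(1,2,4) this assms(8)]
  note fin = clump(1) and \<tau> = clump(4,5) and dens = clump(6)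
  note bij = assms(3) and \<sigma> = assms(9) and G = assms(10) and \<nu> = assms(11) and rr = assms(12)
    and n = assms(13) and a = assms(14) and I = assms(15) and J = assms(16)
  have s: "s \<ge> 1" and m: "real m > 0" "6 * real s \<le> m" using assms(1,2) by auto
  have xX: "x k \<in> X" if "k \<in> {1..s}" for k using bij that by (auto simp: bij_betw_def)
  define Y where "Y k = near_set (x k) \<tau> X - {x k}" for k
  \<comment> \<open>\<open>N k\<close> bounds the degree left after the far factors, and
    \<open>t k\<close> is the equal share of each near node; \<open>a k\<close> turns out to be 1 /
    (2 t k).\<close>
  define N where "N k = m - 2 * \<nu> k / \<tau>" for k
  define t where "t k = N k / rr k" for k
  define d where "d k y = \<bar>y - x k\<bar>\<^sub>T" for k y
  define qy where "qy k y = min (nat \<lfloor>t k\<rfloor>) (nat \<lfloor>1 / (2 * d k y)\<rfloor>)" for k y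
  define E where "E k = 1 / real (nat \<lfloor>t k\<rfloor>) * (\<Prod>y\<in>Y k. 1 / (sin (pi * qy k y * d k y))\<^sup>2)" for k
  have spars: "local_sparsity \<tau> U \<le> lam" if "U \<subseteq> X" for U
    using local_sparsity_le[OF fin that clump(8)] .
  have \<nu>l: "\<nu> k \<le> lam" for k unfolding \<nu> G by (rule spars) (auto simp: far_set_def)
  have lam\<tau>: "3 * real lam \<le> m * \<tau>" using dens \<tau> by (simp add: pos_divide_le_eq)
  have finY: "finite (Y k)" for k using fin by (simp add: Y_def near_set_def)
  have nearY: "near_set (x k) \<tau> X = insert (x k) (Y k)" if "k \<in> {1..s}" for k
    using xX[OF that] \<tau> by (auto simp: Y_def near_set_def)
  have xY: "x k \<notin> Y k" for k by (simp add: Y_def)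
  have rrY: "rr k = card (Y k) + 1" if "k \<in> {1..s}" for k
    unfolding rr nearY[OF that] using finY[of k] xY[of k] by simp
  have rrl: "rr k \<le> lam" if "k \<in> {1..s}" for k
    unfolding rr near_set_def by (rule clump(8)[OF xX[OF that]])
  have rrs: "rr k \<le> s" for k
    unfolding rr near_set_def clump(2)[symmetric] using fin by (intro card_mono) auto
  \<comment> \<open>The density bound lets the far factors use at most two thirds of
    \<open>m\<close>.\<close>
  have N: "m \<le> 3 * N k" "N k \<le> m" for k
  proof -
    have "2 * \<nu> k / \<tau> \<le> 2 * lam / \<tau>" using \<nu>l[of k] \<tau> by (intro divide_right_mono) auto
    then show "m \<le> 3 * N k" using dens unfolding N_def by simp
    show "N k \<le> m" unfolding N_def using \<tau> by simp
  qed
  have rrpos: "real (rr k) \<ge> 1" if "k \<in> {1..s}" for k using rrY[OF that] by simp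
  \<comment> \<open>Here m >= 6 s enters: 2 \<open>rr k\<close> <= 2 s <= m / 3 <=
    \<open>N k\<close>.\<close>
  have t2: "2 \<le> t k" if "k \<in> {1..s}" for k
  proof -
    have "2 * real (rr k) \<le> N k" using N(1)[of k] m rrs[of k] by linarith
    then show ?thesis using rrpos[OF that] by (simp add: t_def pos_le_divide_eq)
  qed
  have at: "a k = 1 / (2 * t k)" for k
    unfolding a t_def N_def by (simp add: algebra_simps)
  have apos: "0 < a k" "a k \<le> 1 / 4" if "k \<in> {1..s}" for k
    unfolding at using t2[OF that] by (auto simp: divide_le_eq)
  \<comment> \<open>Ensures that the nodes in \<open>I k\<close>, cut off at \<open>a k\<close>, are
    near nodes.\<close>
  have a\<tau>: "a k \<le> \<tau>" if "k \<in> {1..s}" for k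
  proof -
    have "real (rr k) \<le> \<tau> * N k"
    proof -
      have "3 * real (rr k) \<le> m * \<tau>" using lam\<tau> rrl[OF that] by linarith
      also have "m * \<tau> \<le> 3 * N k * \<tau>" using N(1)[of k] \<tau> by (intro mult_right_mono) auto
      finally show ?thesis by (simp add: mult.commute)
    qed
    moreover have "N k > 0" using N(1)[of k] m by linarith
    ultimately have "real (rr k) / N k \<le> \<tau>" by (simp add: pos_divide_le_eq)
    moreover have "a k = real (rr k) / N k / 2" unfolding at t_def by simp
    ultimately show ?thesis using \<tau> by simp
  qed
  have dY: "0 < d k y \<and> d k y \<le> 1 / 2" if "y \<in> Y k" for k y
  proof -
    have "d k y \<noteq> 0" using that unfolding d_def Y_def by simp
    then show ?thesis unfolding d_def using torus_norm_nonneg[of "y - x k"] torus_norm_le_half[of "y - x k"] by linarith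
  qed
  have IY: "I k = {y\<in>Y k. d k y \<le> a k}" if "k \<in> {1..s}" for k
    unfolding I Y_def near_set_def d_def using a\<tau>[OF that]
    by (auto simp: torus_norm_minus_commute[of "x k"] less_le)
  have JY: "J k = {y\<in>Y k. a k < d k y}" if "k \<in> {1..s}" for k
    unfolding J Y_def near_set_def d_def using apos[OF that]
    by (auto simp: torus_norm_minus_commute[of "x k"])
  have N\<delta>: "N k * \<delta> \<le> 1" for k
  proof -
    have "N k * \<delta> \<le> m * \<delta>" using N(2) assms(5) by (simp add: mult_right_mono)
    also have "\<dots> \<le> 1" using assms(6) m by (simp add: pos_le_divide_eq mult.commute)
    finally show ?thesis .
  qed
  have nN: "n k = \<lfloor>N k\<rfloor>" for k unfolding n N_def ..

  \<comment> \<open>Interpolating polynomials for all nodes\<close>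
  define Q where "Q k p \<longleftrightarrow> degree p < m \<and> poly p (zeta (x k)) = 1 \<and>
    (\<forall>u\<in>X. u \<noteq> x k \<longrightarrow> poly p (zeta u) = 0) \<and> (\<Sum>i<m. (norm (coeff p i))\<^sup>2) \<le> 2 ^ \<nu> k * E k"
    for k and p :: "complex poly"
  have "\<exists>p. Q k p" if k: "k \<in> {1..s}" for k
  proof -
    have t1: "1 \<le> t k" using t2[OF k] by simp
    have "real (rr k) * real (nat \<lfloor>t k\<rfloor>) \<le> N k"
    proof -
      have "real (nat \<lfloor>t k\<rfloor>) \<le> N k / rr k" using nat_floor_bounds(3)[OF t1] unfolding t_def .
      then show ?thesis using rrpos[OF k] by (simp add: pos_le_divide_eq mult.commute)
    qed
    moreover have "real (\<nu> k) * real (nat \<lfloor>2 / \<tau>\<rfloor>) \<le> 2 * \<nu> k / \<tau>"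
    proof -
      have "1 \<le> 2 / \<tau>" using \<tau> by simp
      from mult_left_mono[OF nat_floor_bounds(3)[OF this], of "real (\<nu> k)"] show ?thesis by (simp add: mult.commute)
    qed
    ultimately have "real (rr k * nat \<lfloor>t k\<rfloor> + \<nu> k * nat \<lfloor>2 / \<tau>\<rfloor>) \<le> m"
      unfolding N_def by simp
    then have deg: "rr k * nat \<lfloor>t k\<rfloor> + \<nu> k * nat \<lfloor>2 / \<tau>\<rfloor> \<le> m" by (simp only: of_nat_le_iff)
    obtain p :: "complex poly" where "degree p < m" "poly p (zeta (x k)) = 1"
      "\<And>u. \<lbrakk>u \<in> X; u \<noteq> x k\<rbrakk> \<Longrightarrow> poly p (zeta u) = 0"
      "(\<Sum>i<m. (norm (coeff p i))\<^sup>2) \<le> 2 ^ local_sparsity \<tau> (far_set (x k) \<tau> X) / real (nat \<lfloor>t k\<rfloor>) *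
         (\<Prod>y\<in>near_set (x k) \<tau> X - {x k}. 1 / (sin (pi * qy k y * \<bar>y - x k\<bar>\<^sub>T))\<^sup>2)"
    proof (rule node_interpolant[OF fin xX[OF k] \<tau> nat_floor_bounds(1)[OF t1] deg[unfolded rr \<nu> G], of "qy k"])
      show "qy k y \<le> nat \<lfloor>t k\<rfloor>" for y by (simp add: qy_def)
      show "sin (pi * real (qy k y) * \<bar>y - x k\<bar>\<^sub>T) \<noteq> 0" if "y \<in> near_set (x k) \<tau> X - {x k}" for y
        using sin_capped_pos[OF nat_floor_bounds(1)[OF t1], of "d k y"] dY[of y k] that
        unfolding qy_def d_def Y_def by auto
    qed blast
    then show ?thesis
      unfolding Q_def E_def Y_def[symmetric] \<nu>[symmetric] G[symmetric] d_def[symmetric] by (intro exI[of _ p]) simp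
  qed
  then have "\<forall>k\<in>{1..s}. \<exists>p. Q k p" by simp
  from bchoice[OF this] obtain p where "\<forall>k\<in>{1..s}. Q k (p k)" ..
  then have p: "degree (p k) < m" "poly (p k) (zeta (x k)) = 1"
    "\<lbrakk>u \<in> X; u \<noteq> x k\<rbrakk> \<Longrightarrow> poly (p k) (zeta u) = 0"
    "(\<Sum>i<m. (norm (coeff (p k) i))\<^sup>2) \<le> 2 ^ \<nu> k * E k" if "k \<in> {1..s}" for k u
    using that unfolding Q_def by simp_all
  have val: "poly (p k) (zeta (x l)) = (if l = k then 1 else 0)" if "k \<in> {1..s}" "l \<in> {1..s}" for k l
  proof (cases "l = k")
    case True
    then show ?thesis using p(2)[OF that(1)] by simp
  next
    case False
    then have "x l \<noteq> x k" using bij that by (auto simp: bij_betw_def dest: inj_onD)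
    then show ?thesis using p(3)[OF that(1) xX[OF that(2)]] False by simp
  qed
  note sv = singular_value_fourier_matrix_bound[OF s p(1) val, folded \<sigma>]
  have \<sigma>pos: "\<sigma> > 0" using sv(1) .
  have \<sigma>E: "1 / \<sigma>\<^sup>2 \<le> (\<Sum>k=1..s. 2 ^ \<nu> k * E k)"
    using sv(2) sum_mono[OF p(4)] by (rule order_trans)

  \<comment> \<open>First bound: products over the near nodes\<close>
  define T1 where "T1 k = 2 ^ \<nu> k * (2 * a k / (1 - 2 * a k)) * (\<Prod>y\<in>J k. (phi (1 / (2 * \<bar>y - x k\<bar>\<^sub>T)))\<^sup>2) *
                 (\<Prod>y\<in>I k. (a k)\<^sup>2 / ((1 - 2 * a k)\<^sup>2 * \<bar>y - x k\<bar>\<^sub>T\<^sup>2))" for k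
  have ET1: "2 ^ \<nu> k * E k \<le> T1 k" if k: "k \<in> {1..s}" for k
  proof -
    have "E k \<le> 2 * a k / (1 - 2 * a k) * (\<Prod>y\<in>{y\<in>Y k. a k < d k y}. (phi (1 / (2 * d k y)))\<^sup>2) *
      (\<Prod>y\<in>{y\<in>Y k. d k y \<le> a k}. (a k)\<^sup>2 / ((1 - 2 * a k)\<^sup>2 * (d k y)\<^sup>2))"
      unfolding E_def qy_def by (rule node_product_le_first[OF finY t2[OF k] dY at])
    then have "2 ^ \<nu> k * E k \<le> 2 ^ \<nu> k * (2 * a k / (1 - 2 * a k) * (\<Prod>y\<in>J k. (phi (1 / (2 * d k y)))\<^sup>2) *
      (\<Prod>y\<in>I k. (a k)\<^sup>2 / ((1 - 2 * a k)\<^sup>2 * (d k y)\<^sup>2)))"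
      unfolding IY[OF k] JY[OF k] by (rule mult_left_mono) simp
    then show ?thesis unfolding T1_def d_def by (simp only: mult.assoc)
  qed
  have bound1: "1 / \<sigma>\<^sup>2 \<le> (\<Sum>k=1..s. T1 k)"
    using \<sigma>E sum_mono[OF ET1] by (rule order_trans)

  \<comment> \<open>Second bound: minimum form of the first\<close>
  define b2 where "b2 k = 1 / sqrt (4 * s * a k) * (1 / sqrt (2 ^ \<nu> k)) * (1 / 2 ^ card (J k)) *
                 (\<Prod>y\<in>I k. \<bar>y - x k\<bar>\<^sub>T / (2 * a k))" for k
  have bound2: "(MIN k\<in>{1..s}. b2 k) \<le> \<sigma>"
  proof (rule min_le_of_inverse_square_bound[OF s \<sigma>pos bound1])
    fix k assume k: "k \<in> {1..s}"
    define P where "P = (\<Prod>y\<in>I k. \<bar>y - x k\<bar>\<^sub>T / (2 * a k))"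
    have IJ: "finite (I k)" "finite (J k)" using finY by (simp_all add: IY[OF k] JY[OF k])
    have dI: "0 < \<bar>y - x k\<bar>\<^sub>T" if "y \<in> I k" for y using that by (simp add: I)
    have dJ: "0 < \<bar>y - x k\<bar>\<^sub>T \<and> \<bar>y - x k\<bar>\<^sub>T \<le> 1 / 2" if "y \<in> J k" for y
      using that dY[of y k] by (simp add: JY[OF k] d_def)
    have P: "P > 0" unfolding P_def using dI apos[OF k] by (intro prod_pos) auto
    have "T1 k \<le> 4 * a k * 2 ^ \<nu> k * (2 ^ card (J k))\<^sup>2 / P\<^sup>2"
      unfolding T1_def P_def by (rule first_le_second[OF IJ(2,1) apos[OF k] dJ dI])
    also have "\<dots> = 1 / (real s * (b2 k)\<^sup>2)"
      unfolding b2_def P_def[symmetric] using s P apos[OF k]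
      by (simp add: power_mult_distrib power_divide)
    finally show "0 < b2 k \<and> T1 k \<le> 1 / (real s * (b2 k)\<^sup>2)"
      unfolding b2_def P_def[symmetric] using s P apos[OF k] by simp
  qed

  \<comment> \<open>Third bound: dependence on the separation only\<close>
  define T3 where "T3 k = 2 ^ \<nu> k * (phi (n k / rr k) / (rr k * n k)) *
                 (2 * exp 1 * phi (n k / rr k) / sin (pi / 2 * n k * \<delta>)) ^ (2 * rr k - 2)" for k
  have ET3: "2 ^ \<nu> k * E k \<le> 4 * (exp 1)\<^sup>2 / pi\<^sup>2 * T3 k" if k: "k \<in> {1..s}" for k
  proof -
    \<comment> \<open>The sign of the lift records on which side of \<open>x k\<close> the node
      lies.\<close>
    have "\<exists>T. y - x k = abs_torus T \<and> \<bar>T\<bar> = d k y" for y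
      unfolding d_def by (metis torus_rep)
    then obtain T where T: "\<And>y. y - x k = abs_torus (T y)" "\<And>y. \<bar>T y\<bar> = d k y" by metis
    have "E k \<le> 4 * (exp 1)\<^sup>2 / pi\<^sup>2 * (phi (n k / rr k) / (rr k * n k)) *
       (2 * exp 1 * phi (n k / rr k) / sin (pi / 2 * n k * \<delta>)) ^ (2 * rr k - 2)"
      unfolding E_def qy_def
    proof (rule node_product_le_third[OF finY rrY[OF k] t_def t2[OF k] nN _ _ assms(5) N\<delta>])
      fix y assume y: "y \<in> Y k"
      have "y \<in> X" "y \<noteq> x k" using y by (auto simp: Y_def near_set_def)
      then have "\<delta> \<le> d k y" unfolding d_def using clump(3) xX[OF k] by blast
      then show "\<delta> \<le> \<bar>T y\<bar> \<and> \<bar>T y\<bar> = d k y \<and> d k y \<le> 1 / 2" using T(2) dY[OF y] by simp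
    next
      fix y y' assume y: "y \<in> Y k" "y' \<in> Y k" "y \<noteq> y'"
      have "y - y' = (y - x k) - (y' - x k)" by simp
      also have "\<dots> = abs_torus (T y - T y')" unfolding T(1) by (rule minus_torus.abs_eq)
      finally have "\<bar>y - y'\<bar>\<^sub>T \<le> \<bar>T y - T y'\<bar>" using torus_norm_abs_torus_le[of "T y - T y'" 0] by simp
      moreover have "\<delta> \<le> \<bar>y - y'\<bar>\<^sub>T" using clump(3) y by (auto simp: Y_def near_set_def)
      ultimately show "\<delta> \<le> \<bar>T y - T y'\<bar>" by simp
    qed
    from mult_left_mono[OF this, of "2 ^ \<nu> k"] show ?thesis unfolding T3_def by (simp only: mult_ac) simp
  qed
  have bound3: "1 / \<sigma>\<^sup>2 \<le> 4 * (exp 1)\<^sup>2 / pi\<^sup>2 * (\<Sum>k=1..s. T3 k)"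
    unfolding sum_distrib_left using \<sigma>E sum_mono[OF ET3] by (rule order_trans)

  \<comment> \<open>Fourth bound and its uniform version\<close>
  define w where "w = m * \<delta> / (12 * exp 1)"
  define c where "c = pi / (2 * exp 1) * sqrt (m / (6 * s))"
  define b4 where "b4 k = sqrt (rr k / 2 ^ \<nu> k) * w ^ (rr k - 1)" for k
  have w: "0 < w" "w \<le> 1"
  proof -
    show "0 < w" using m assms(5) by (simp add: w_def)
    have "m * \<delta> \<le> 1" using assms(6) m by (simp add: pos_le_divide_eq mult.commute)
    moreover have "(1::real) \<le> 12 * exp 1" using exp_ge_add_one_self[of 1] by linarith
    ultimately show "w \<le> 1" by (simp add: w_def pos_divide_le_eq)
  qed
  have c: "c > 0" using s m by (simp add: c_def)
  have min4: "(MIN k\<in>{1..s}. c * b4 k) \<le> \<sigma>"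
  proof (rule min_le_of_inverse_square_bound[OF s \<sigma>pos \<sigma>E])
    fix k assume k: "k \<in> {1..s}"
    have r1: "1 \<le> rr k" using rrY[OF k] by simp
    have b4: "b4 k > 0" unfolding b4_def using w rrpos[OF k] by simp
    have "2 ^ \<nu> k * E k \<le> 4 * (exp 1)\<^sup>2 / pi\<^sup>2 * T3 k" by (rule ET3[OF k])
    also have "\<dots> = 2 ^ \<nu> k * (4 * (exp 1)\<^sup>2 / pi\<^sup>2 * (phi (n k / rr k) / (rr k * n k)) *
       (2 * exp 1 * phi (n k / rr k) / sin (pi / 2 * n k * \<delta>)) ^ (2 * rr k - 2))"
      unfolding T3_def by (simp only: mult_ac)
    also have "\<dots> \<le> 2 ^ \<nu> k * (4 * (exp 1)\<^sup>2 / pi\<^sup>2 * (6 / (real m * rr k)) * (12 * exp 1 / (real m * \<delta>)) ^ (2 * rr k - 2))"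
      by (rule mult_left_mono[OF third_le_fourth[OF r1 t_def t2[OF k] nN m(1) N(1) assms(5) N\<delta>]]) simp
    also have "\<dots> = 1 / (real s * (c * b4 k)\<^sup>2)"
    proof -
      have "(12 * exp 1 / (real m * \<delta>)) ^ (2 * rr k - 2) = 1 / (w ^ (rr k - 1))\<^sup>2"
      proof -
        have "2 * rr k - 2 = (rr k - 1) * 2" by simp
        then show ?thesis unfolding w_def by (simp only: power_mult) (simp add: power_divide)
      qed
      moreover have "c\<^sup>2 = pi\<^sup>2 / (4 * (exp 1)\<^sup>2) * (m / (6 * s))"
        unfolding c_def using s m by (simp add: power_mult_distrib power_divide)
      moreover have "(b4 k)\<^sup>2 = rr k / 2 ^ \<nu> k * (w ^ (rr k - 1))\<^sup>2"
        unfolding b4_def by (simp add: power_mult_distrib)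
      ultimately show ?thesis using s by (simp add: power_mult_distrib mult_ac)
    qed
    finally show "0 < c * b4 k \<and> 2 ^ \<nu> k * E k \<le> 1 / (real s * (c * b4 k)\<^sup>2)" using b4 c by simp
  qed
  \<comment> \<open>Serves both remaining bounds: the constant \<open>c\<close> outside the minimum
    and the uniform estimate.\<close>
  have lower: "C \<le> \<sigma>" if "\<And>k. k \<in> {1..s} \<Longrightarrow> C \<le> c * b4 k" for C
  proof -
    have "C \<le> (MIN k\<in>{1..s}. c * b4 k)" using s that by (intro Min.boundedI) auto
    then show ?thesis using min4 by simp
  qed
  have bound4: "c * (MIN k\<in>{1..s}. b4 k) \<le> \<sigma>"
    using c s by (intro lower mult_left_mono Min_le) auto
  have bound5: "pi / (2 * exp 1) * sqrt (m / (12 * s)) * (m * \<delta> / (12 * sqrt 2 * exp 1)) ^ (lam - 1) \<le> \<sigma>"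
  proof (rule lower)
    fix k assume k: "k \<in> {1..s}"
    have "pi / (2 * exp 1) * sqrt (m / (12 * s)) * (m * \<delta> / (12 * sqrt 2 * exp 1)) ^ (lam - 1)
        = c * (1 / sqrt 2 * (w / sqrt 2) ^ (lam - 1))"
    proof -
      \<comment> \<open>The leading 1 / sqrt 2 of the uniform estimate turns 6 s into 12 s under the
        root.\<close>
      have "m / (12 * s) = m / (6 * s) / 2" by simp
      then have "sqrt (m / (12 * s)) = sqrt (m / (6 * s)) / sqrt 2" by (simp only: real_sqrt_divide)
      moreover have "m * \<delta> / (12 * sqrt 2 * exp 1) = w / sqrt 2" by (simp add: w_def)
      ultimately show ?thesis unfolding c_def by simp
    qed
    also have "\<dots> \<le> c * b4 k"
      unfolding b4_def using c rrY[OF k] by (intro mult_left_mono uniform_le_node_bound w rrl[OF k] \<nu>l) auto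
    finally show "pi / (2 * exp 1) * sqrt (m / (12 * s)) * (m * \<delta> / (12 * sqrt 2 * exp 1)) ^ (lam - 1) \<le> c * b4 k" .
  qed
  have "density_criterion m \<tau> X"
  proof -
    have "3 * real (local_sparsity \<tau> X) / \<tau> \<le> 3 * lam / \<tau>"
      using spars[of X] \<tau> by (intro divide_right_mono) auto
    then show ?thesis unfolding density_criterion_def using dens by simp
  qed
  then show ?thesis
    using bound1 bound2 bound3 bound4 bound5
    unfolding T1_def b2_def T3_def b4_def c_def w_def by (intro conjI) assumption+
qed

end
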